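(* Let $\mathbb{K}$ be an algebraically closed field of characteristic $0$, let $q\in\mathbb{K}$ be nonzero and not a root of unity, and let $V$ be a vector space over $\mathbb{K}$ with finite positive dimension. Let $A,A^*$ be a tridiagonal pair on $V$ of diameter $d$ which satisfies the $q$-Serre relations $$A^3A^*-[3]A^2A^*A+[3]AA^*A^2-A^*A^3=0,$$ $$A^{*3}A-[3]A^{*2}AA^*+[3]A^*AA^{*2}-AA^{*3}=0,$$ where $[3]=(q^3-q^{-3})/(q-q^{-1})$. Let $a,a^*\in\mathbb{K}$ be such that $\theta_i=aq^{2i-d}$ $(0\le i\le d)$ is a standard ordering of the eigenvalues of $A$ and $\theta^*_i=a^*q^{d-2i}$ $(0\le i\le d)$ is a standard ordering of the eigenvalues of $A^*$. Let $U_0,U_1,\ldots,U_d$ denote the split decomposition for $A,A^*$ with respect to these orderings, and let $R$ and $L$ denote the corresponding raising and lowering maps. Let $v$ denote a nonzero vector in $U_0$. Then for $0\le i\le d$ the space $U_i$ is spanned by the vectors of the form $$L^{i_1}R^{i_2}L^{i_3}R^{i_4}\cdots R^{i_n}v,$$ where $i_1,i_2,\ldots,i_n$ ranges over all sequences such that (i) $n$ is a nonnegative even integer; (ii) $i_1,i_2,\ldots,i_n$ are integers satisfying $0\le i_1<i_2<\cdots<i_n\le d$ and $i=\sum_{h=1}^n i_h(-1)^h$.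
   Context: A linear transformation $V\to V$ is diagonalizable if $V$ is spanned by its eigenspaces. Tridiagonal pair: an ordered pair $A,A^*$ of linear transformations $V\to V$ (here $A^*$ is just a name; it is not the conjugate-transpose of $A$) such that (i) each of $A,A^*$ is diagonalizable; (ii) there is an ordering $V_0,V_1,\ldots,V_d$ of the eigenspaces of $A$ with $A^*V_i\subseteq V_{i-1}+V_i+V_{i+1}$ for $0\le i\le d$, where $V_{-1}=V_{d+1}=0$; (iii) there is an ordering $V^*_0,V^*_1,\ldots,V^*_\delta$ of the eigenspaces of $A^*$ with $AV^*_i\subseteq V^*_{i-1}+V^*_i+V^*_{i+1}$ for $0\le i\le\delta$, where $V^*_{-1}=V^*_{\delta+1}=0$; (iv) there is no subspace $W$ of $V$ with $AW\subseteq W$, $A^*W\subseteq W$, $W\ne0$, $W\ne V$. It is known that $d=\delta$; this common value is the diameter. Orderings of eigenspaces as in (ii), (iii) are called standard, and an ordering of the eigenvalues of $A$ (resp. $A^*$) is called standard when the corresponding ordering of eigenspaces is standard. Under the $q$-Serre relations, standard orderings of the form $\theta_i=aq^{2i-d}$ and $\theta_i^*=a^*q^{d-2i}$ are known to exist. Split decomposition: it is known that, given standard orderings $\theta_0,\ldots,\theta_d$ and $\theta_0^*,\ldots,\theta_d^*$ of the eigenvalues of $A$ and $A^*$, there is a unique sequence $U_0,\ldots,U_d$ of subspaces of $V$ such that $V=U_0+U_1+\cdots+U_d$ (direct sum), $(A-\theta_iI)U_i\subseteq U_{i+1}$ for $0\le i<d$, $(A-\theta_dI)U_d=0$, $(A^*-\theta^*_iI)U_i\subseteq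 U_{i-1}$ for $0<i\le d$, and $(A^*-\theta^*_0I)U_0=0$. This sequence is the split decomposition with respect to these orderings. Raising and lowering maps: for $0\le i\le d$ let $F_i:V\to V$ be the projection onto $U_i$, i.e. $(F_i-I)U_i=0$ and $F_iU_j=0$ for $j\ne i$. Then $R=A-\sum_{h=0}^d\theta_hF_h$ is the raising map and $L=A^*-\sum_{h=0}^d\theta^*_hF_h$ is the lowering map. For $n=0$ the displayed vector is $v$. The exponents alternate: $L$ carries the odd-indexed exponents and $R$ carries the even-indexed exponents. *)

theory Defs
  imports
    Complex_Main
    "HOL-Computational_Algebra.Polynomial"
    "HOL-Library.FuncSet"
    "HOL-Library.Set_Algebras"
begin

definition q_int :: "'a::field \<Rightarrow> int \<Rightarrow> 'a" where
  "q_int q n = (q powi n - q powi (- n)) / (q - q powi (- 1))"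

(* alt_word L R [i1, i2, i3, ...] v is the vector L^i1 (R^i2 (L^i3 (... v))):
   the recursive call exchanges the roles of L and R. *)
primrec alt_word :: "nat list \<Rightarrow> ('v \<Rightarrow> 'v) \<Rightarrow> ('v \<Rightarrow> 'v) \<Rightarrow> 'v \<Rightarrow> 'v" where
  "alt_word [] L R v = v"
| "alt_word (j # js) L R v = (L ^^ j) (alt_word js R L v)"

(* The list entry js ! (h - 1) is the term i_h of the sequence i_1, ..., i_n. *)
definition admissible :: "nat \<Rightarrow> nat \<Rightarrow> nat list \<Rightarrow> bool" where
  "admissible d i js \<longleftrightarrow>
     even (length js) \<and> sorted_wrt (<) js \<and> (\<forall>j\<in>set js. j \<le> d) \<and>
     int i = (\<Sum>h = 1..length js. int (js ! (h - 1)) * (- 1) ^ h)"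

definition eigenspace ::
    "('k::field \<Rightarrow> 'v::ab_group_add \<Rightarrow> 'v) \<Rightarrow> ('v \<Rightarrow> 'v) \<Rightarrow> 'k \<Rightarrow> 'v set" where
  "eigenspace scale A \<theta> = {v. A v = scale \<theta> v}"

definition eigenvalues ::
    "('k::field \<Rightarrow> 'v::ab_group_add \<Rightarrow> 'v) \<Rightarrow> ('v \<Rightarrow> 'v) \<Rightarrow> 'k set" where
  "eigenvalues scale A = {\<theta>. \<exists>v. v \<noteq> 0 \<and> A v = scale \<theta> v}"

definition eigenspaces ::
    "('k::field \<Rightarrow> 'v::ab_group_add \<Rightarrow> 'v) \<Rightarrow> ('v \<Rightarrow> 'v) \<Rightarrow> 'v set set" where
  "eigenspaces scale A = eigenspace scale A ` eigenvalues scale A"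

definition diagonalizable ::
    "('k::field \<Rightarrow> 'v::ab_group_add \<Rightarrow> 'v) \<Rightarrow> ('v \<Rightarrow> 'v) \<Rightarrow> bool" where
  "diagonalizable scale A \<longleftrightarrow> module.span scale (\<Union> (eigenspaces scale A)) = UNIV"

(* The integer-indexed extension of V_0, ..., V_d with V_i = 0 for i < 0 and i > d. *)
definition zero_ext :: "nat \<Rightarrow> (nat \<Rightarrow> 'v::zero set) \<Rightarrow> int \<Rightarrow> 'v set" where
  "zero_ext d V i = (if 0 \<le> i \<and> i \<le> int d then V (nat i) else {0})"

definition standard_eigenspaces ::
    "('k::field \<Rightarrow> 'v::ab_group_add \<Rightarrow> 'v) \<Rightarrow> ('v \<Rightarrow> 'v) \<Rightarrow> ('v \<Rightarrow> 'v) \<Rightarrow> nat \<Rightarrow> (nat \<Rightarrow> 'v set) \<Rightarrow> bool" where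
  "standard_eigenspaces scale A B d V \<longleftrightarrow>
     bij_betw V {..d} (eigenspaces scale A) \<and>
     (\<forall>i\<le>d. B ` V i \<subseteq>
        zero_ext d V (int i - 1) + zero_ext d V (int i) + zero_ext d V (int i + 1))"

definition standard_eigenvalues ::
    "('k::field \<Rightarrow> 'v::ab_group_add \<Rightarrow> 'v) \<Rightarrow> ('v \<Rightarrow> 'v) \<Rightarrow> ('v \<Rightarrow> 'v) \<Rightarrow> nat \<Rightarrow> (nat \<Rightarrow> 'k) \<Rightarrow> bool" where
  "standard_eigenvalues scale A B d \<theta> \<longleftrightarrow>
     bij_betw \<theta> {..d} (eigenvalues scale A) \<and>
     standard_eigenspaces scale A B d (\<lambda>i. eigenspace scale A (\<theta> i))"

definition tridiagonal_pair ::
    "('k::field \<Rightarrow> 'v::ab_group_add \<Rightarrow> 'v) \<Rightarrow> ('v \<Rightarrow> 'v) \<Rightarrow> ('v \<Rightarrow> 'v) \<Rightarrow> bool" where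
  "tridiagonal_pair scale A As \<longleftrightarrow>
     Vector_Spaces.linear scale scale A \<and> Vector_Spaces.linear scale scale As \<and>
     diagonalizable scale A \<and> diagonalizable scale As \<and>
     (\<exists>d V. standard_eigenspaces scale A As d V) \<and>
     (\<exists>\<delta> Vs. standard_eigenspaces scale As A \<delta> Vs) \<and>
     \<not> (\<exists>W. module.subspace scale W \<and> A ` W \<subseteq> W \<and> As ` W \<subseteq> W \<and> W \<noteq> {0} \<and> W \<noteq> UNIV)"

definition has_diameter ::
    "('k::field \<Rightarrow> 'v::ab_group_add \<Rightarrow> 'v) \<Rightarrow> ('v \<Rightarrow> 'v) \<Rightarrow> ('v \<Rightarrow> 'v) \<Rightarrow> nat \<Rightarrow> bool" where
  "has_diameter scale A As d \<longleftrightarrow>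
     (\<exists>V. standard_eigenspaces scale A As d V) \<and> (\<exists>Vs. standard_eigenspaces scale As A d Vs)"

definition q_Serre ::
    "('k::field \<Rightarrow> 'v::ab_group_add \<Rightarrow> 'v) \<Rightarrow> 'k \<Rightarrow> ('v \<Rightarrow> 'v) \<Rightarrow> ('v \<Rightarrow> 'v) \<Rightarrow> bool" where
  "q_Serre scale q A B \<longleftrightarrow>
     (\<forall>v. (A ^^ 3) (B v) - scale (q_int q 3) ((A ^^ 2) (B (A v)))
          + scale (q_int q 3) (A (B ((A ^^ 2) v))) - B ((A ^^ 3) v) = 0)"

definition direct_decomposition ::
    "('k::field \<Rightarrow> 'v::ab_group_add \<Rightarrow> 'v) \<Rightarrow> nat \<Rightarrow> (nat \<Rightarrow> 'v set) \<Rightarrow> bool" where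
  "direct_decomposition scale d U \<longleftrightarrow>
     (\<forall>i\<le>d. module.subspace scale (U i)) \<and>
     (\<forall>v. \<exists>!u. u \<in> PiE {..d} U \<and> v = (\<Sum>i\<le>d. u i))"

definition split_decomposition ::
    "('k::field \<Rightarrow> 'v::ab_group_add \<Rightarrow> 'v) \<Rightarrow> ('v \<Rightarrow> 'v) \<Rightarrow> ('v \<Rightarrow> 'v) \<Rightarrow> nat \<Rightarrow> (nat \<Rightarrow> 'k) \<Rightarrow> (nat \<Rightarrow> 'k) \<Rightarrow>
     (nat \<Rightarrow> 'v set) \<Rightarrow> bool" where
  "split_decomposition scale A As d \<theta> \<theta>s U \<longleftrightarrow>
     direct_decomposition scale d U \<and>
     (\<forall>i<d. \<forall>u\<in>U i. A u - scale (\<theta> i) u \<in> U (i + 1)) \<and>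
     (\<forall>u\<in>U d. A u - scale (\<theta> d) u = 0) \<and>
     (\<forall>i\<in>{1..d}. \<forall>u\<in>U i. As u - scale (\<theta>s i) u \<in> U (i - 1)) \<and>
     (\<forall>u\<in>U 0. As u - scale (\<theta>s 0) u = 0)"

(* Well defined only when direct_decomposition scale d U holds and i \<le> d. *)
definition projection ::
    "('k::field \<Rightarrow> 'v::ab_group_add \<Rightarrow> 'v) \<Rightarrow> nat \<Rightarrow> (nat \<Rightarrow> 'v set) \<Rightarrow> nat \<Rightarrow> 'v \<Rightarrow> 'v" where
  "projection scale d U i = (THE F. Vector_Spaces.linear scale scale F \<and>
     (\<forall>u\<in>U i. F u - u = 0) \<and> (\<forall>j\<le>d. j \<noteq> i \<longrightarrow> (\<forall>u\<in>U j. F u = 0)))"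

definition raising ::
    "('k::field \<Rightarrow> 'v::ab_group_add \<Rightarrow> 'v) \<Rightarrow> ('v \<Rightarrow> 'v) \<Rightarrow> nat \<Rightarrow> (nat \<Rightarrow> 'k) \<Rightarrow>
     (nat \<Rightarrow> 'v set) \<Rightarrow> 'v \<Rightarrow> 'v" where
  "raising scale A d \<theta> U v = A v - (\<Sum>h\<le>d. scale (\<theta> h) (projection scale d U h v))"

definition lowering ::
    "('k::field \<Rightarrow> 'v::ab_group_add \<Rightarrow> 'v) \<Rightarrow> ('v \<Rightarrow> 'v) \<Rightarrow> nat \<Rightarrow> (nat \<Rightarrow> 'k) \<Rightarrow>
     (nat \<Rightarrow> 'v set) \<Rightarrow> 'v \<Rightarrow> 'v" where
  "lowering scale As d \<theta>s U v = As v - (\<Sum>h\<le>d. scale (\<theta>s h) (projection scale d U h v))"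

end

theory Submission
  imports Defs
begin

text \<open>Consider all words in \<open>L\<close> and \<open>R\<close> applied to a nonzero vector $v \in U_0$. Each is homogeneous
for the split decomposition, so their span is invariant under \<open>A\<close> and $A^*$, and by irreducibility
it is all of \<open>V\<close>. It remains to express every word by words with increasing exponents; sorting
these by degree then gives the spanning sets of the $U_i$.

The tool for this are higher $q$-Serre relations for \<open>R\<close> and \<open>L\<close>: if the polynomial
$\sum_x \kappa_x z^x$ of degree at most \<open>n\<close> vanishes at $q^{2k}$ for $|k| \le c$, then
$\sum_x \kappa_x R^x L^c R^{n-x} = 0$, and likewise with \<open>R\<close> and \<open>L\<close> interchanged. They are proved
for the pair \<open>(A, L)\<close> first, where \<open>A\<close> is diagonalizable with nonzero eigenvalues: the $q$-Serre
relation means that \<open>L\<close> maps the eigenspace for $\mu$ to the sum of those for $\mu q^{2}$, $\mu$ and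
$\mu q^{-2}$ (\<open>higher_q_Serre_if_diagonalizable\<close>). Comparing the terms of highest degree replaces
\<open>A\<close> by \<open>R\<close> (\<open>higher_q_Serre_leading_part\<close>). A Vandermonde argument turns these relations into a
flexible rule (\<open>exchange\<close>): any $2c + 1$ of the products $R^x L^c R^{n-x}$ span all of them.

Choosing the products with $x < c$ or $n - x \le c$ removes a valley $i_{h-1} \ge i_h < i_{h+1}$ from
a sequence of exponents. Repeating this leaves sequences that first increase strictly and then
decrease weakly. A decreasing tail $L^a R^b$ with $a > b$ kills \<open>v\<close>, and with $a = b$ it can be
dropped if \<open>v\<close> is an eigenvector of $L^a R^a$. So the words with strictly increasing exponents span
\<open>V\<close>, provided that \<open>v\<close> is a common eigenvector of all $L^n R^n$
(\<open>alt_word_in_span_increasing\<close>).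

The operators $L^n R^n$ commute on $U_0$. Indeed $L^i R^i L^j R^j$ and $L^j R^j L^i R^i$ are
interchanged by the antiautomorphism that reverses words and swaps \<open>L\<close> and \<open>R\<close>, and the exchange
rule rewrites both of them, with the same coefficients, in words with smaller inner exponents; those
with equal inner exponents are fixed by the antiautomorphism (\<open>level_zero_symmetry\<close>).
Hence a common eigenvector $w \in U_0$ exists over an algebraically closed field. The only admissible
sequence of weight 0 is the empty one, so the result for $w$ shows that $U_0$ is the line spanned
by $w$. Every nonzero $v \in U_0$ is therefore itself a common eigenvector.\<close>

section \<open>Linear operators on a vector space\<close>

locale endomorphisms = vector_space scale
  for scale :: "'k::field \<Rightarrow> 'v::ab_group_add \<Rightarrow> 'v" (infixr "*s" 75)
begin

sublocale pair: vector_space_pair scale scale ..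

abbreviation lin :: "('v \<Rightarrow> 'v) \<Rightarrow> bool" where
  "lin \<equiv> Vector_Spaces.linear scale scale"

lemma linI:
  assumes "\<And>x y. f (x + y) = f x + f y" and "\<And>c x. f (c *s x) = c *s f x"
  shows "lin f"
  using assms by (simp add: Vector_Spaces.linear_iff vector_space_axioms)

lemmas lin_simps = pair.linear_add pair.linear_diff pair.linear_scale pair.linear_sum
  pair.linear_0 pair.linear_neg

lemma lin_compose: "lin f \<Longrightarrow> lin g \<Longrightarrow> lin (\<lambda>x. f (g x))"
  by (intro linI) (simp_all add: lin_simps)

lemma lin_funpow: "lin f \<Longrightarrow> lin (f ^^ n)"
  by (induction n) (auto intro!: linI simp: lin_simps)

lemma lin_diff: "lin f \<Longrightarrow> lin g \<Longrightarrow> lin (\<lambda>x. f x - g x)"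
  by (intro linI) (simp_all add: lin_simps scale_right_diff_distrib)

lemma lin_lin_comb: "(\<And>x. x \<in> I \<Longrightarrow> lin (f x)) \<Longrightarrow> lin (\<lambda>u. \<Sum>x\<in>I. c x *s f x u)"
  by (intro linI)
    (simp_all add: lin_simps scale_right_distrib sum.distrib scale_sum_right mult.commute)

lemma lin_zero_on_span:
  assumes "lin f" "\<And>x. x \<in> S \<Longrightarrow> f x = 0" "x \<in> span S" shows "f x = 0"
  using pair.linear_eq_0_on_span assms by blast

lemma lin_span_into:
  assumes f: "lin f" and W: "subspace W" and S: "\<And>x. x \<in> S \<Longrightarrow> f x \<in> W" and x: "x \<in> span S"
  shows "f x \<in> W"
proof -
  have "f x \<in> span (f ` S)" using pair.linear_span_image[OF f] x by blast
  moreover have "span (f ` S) \<subseteq> W" using S W by (intro span_minimal) auto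
  ultimately show ?thesis by blast
qed

lemma lin_invariant_span:
  assumes "lin f" "\<And>x. x \<in> S \<Longrightarrow> f x \<in> span S" "x \<in> span S"
  shows "f x \<in> span S"
  using lin_span_into[OF assms(1) subspace_span] assms by blast

section \<open>The $q$-Serre relation and its higher versions\<close>

lemma q_Serre_iff:
  "q_Serre scale q A B \<longleftrightarrow>
     (\<forall>v. A (A (A (B v))) - q_int q 3 *s A (A (B (A v)))
          + q_int q 3 *s A (B (A (A v))) - B (A (A (A v))) = 0)"
  unfolding q_Serre_def by (simp add: numeral_3_eq_3 numeral_2_eq_2)

lemma q_int_3:
  assumes "q \<noteq> 0" "q ^ 2 \<noteq> 1"
  shows "q_int q 3 * q ^ 2 = (q ^ 2) ^ 2 + q ^ 2 + 1"
proof -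
  have n: "q - inverse q \<noteq> 0"
    using assms by (auto simp: power2_eq_square field_simps)
  have "q_int q 3 = (q^3 - inverse q ^ 3) / (q - inverse q)"
    by (simp add: q_int_def power_int_minus power_inverse power_int_def)
  also have "\<dots> * q^2 = (q ^ 2) ^ 2 + q ^ 2 + 1"
    using n assms by (simp add: field_simps) (simp add: algebra_simps power_numeral_reduce)
  finally show ?thesis .
qed

text \<open>The $q$-Weyl relation \<open>A E - q\<^sup>2 E A = (1 - q\<^sup>2) g\<close> can be checked on joint data: on \<open>x\<close> the
operator \<open>E\<close> acts by \<open>t\<close>, and on \<open>A x - s x\<close> it acts by $q^{-2} t$, so that the contributions of
\<open>A x - s x\<close> cancel and only the diagonal term \<open>s t\<close> remains.\<close>
lemma q_Weyl_relation:
  assumes A: "lin A" and E: "lin E" and S: "span S = UNIV"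
    and on_S: "\<And>x. x \<in> S \<Longrightarrow>
      \<exists>s t. E x = t *s x \<and> q ^ 2 *s E (A x - s *s x) = t *s (A x - s *s x) \<and> s * t = g"
  shows "A (E u) = q ^ 2 *s E (A u) + ((1 - q ^ 2) * g) *s u"
proof -
  let ?T = "\<lambda>u. A (E u) - (q ^ 2 *s E (A u) + ((1 - q ^ 2) * g) *s u)"
  have "lin ?T"
    by (intro linI) (simp_all add: lin_simps[OF A] lin_simps[OF E] scale_right_distrib
      scale_right_diff_distrib algebra_simps)
  moreover have "?T x = 0" if "x \<in> S" for x
  proof -
    obtain s t where st: "E x = t *s x" "q ^ 2 *s E (A x - s *s x) = t *s (A x - s *s x)" "g = s * t"
      using on_S[OF \<open>x \<in> S\<close>] by metis
    have "q ^ 2 *s E (A x) = q ^ 2 *s E (A x - s *s x) + q ^ 2 *s E (s *s x)"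
      by (simp add: lin_simps[OF E] scale_right_diff_distrib)
    also have "\<dots> = t *s (A x - s *s x) + (q ^ 2 * s * t) *s x"
      unfolding st(2) by (simp add: lin_simps[OF E] st(1))
    finally show ?thesis
      by (simp add: st(1,3) lin_simps[OF A] scale_right_diff_distrib scale_left_diff_distrib algebra_simps)
  qed
  ultimately have "?T u = 0" using lin_zero_on_span[of ?T S u] S by blast
  then show ?thesis by simp
qed

text \<open>Moving \<open>D\<close> to the left of all \<open>A\<close> turns the cubic expression into a combination of
\<open>D A\<^sup>3\<close> and \<open>A\<^sup>2\<close>. With \<open>t = q\<^sup>2\<close> and \<open>[3] t = t\<^sup>2 + t + 1\<close>, the first coefficient is
$t^3 - [3]t^2 + [3]t - 1 = (t-1)(t^2 + t + 1 - [3]t) = 0$, and the second is $t^2 + t + 1 - [3]t = 0$.\<close>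
lemma q_Serre_q_Weyl:
  assumes A: "lin A" and q: "q \<noteq> 0" "q ^ 2 \<noteq> 1"
    and w: "\<And>u. A (D u) = q ^ 2 *s D (A u) + g *s u"
  shows "q_Serre scale q A D"
  unfolding q_Serre_iff
proof
  fix u
  define t c where "t = q ^ 2" and "c = q_int q 3"
  have tc: "c * t = t ^ 2 + t + 1" using q_int_3[OF q] by (simp add: t_def c_def)
  have 1: "A (D u) = t *s D (A u) + g *s u" for u using w t_def by simp
  have "A (A (A (D u))) - c *s A (A (D (A u))) + c *s A (D (A (A u))) - D (A (A (A u)))
    = (t^3 - c * t^2 + c * t - 1) *s D (A (A (A u))) + (g * (t^2 + t + 1 - c * (t + 1) + c)) *s A (A u)"
    by (simp add: 1 lin_simps[OF A] scale_right_distrib scale_left_distrib scale_left_diff_distrib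
      scale_right_diff_distrib power2_eq_square power3_eq_cube algebra_simps)
  moreover have "t^3 - c * t^2 + c * t - 1 = 0"
    using tc by algebra
  moreover have "t^2 + t + 1 - c * (t + 1) + c = 0"
    using tc by algebra
  ultimately show "A (A (A (D u))) - c *s A (A (D (A u))) + c *s A (D (A (A u))) - D (A (A (A u))) = 0"
    by simp
qed

lemma q_Serre_diff:
  assumes "lin A" "q_Serre scale q A B" "q_Serre scale q A D"
  shows "q_Serre scale q A (\<lambda>v. B v - D v)"
  unfolding q_Serre_iff
proof
  fix v
  have B: "A (A (A (B v))) = q_int q 3 *s A (A (B (A v))) - q_int q 3 *s A (B (A (A v))) + B (A (A (A v)))"
    and D: "A (A (A (D v))) = q_int q 3 *s A (A (D (A v))) - q_int q 3 *s A (D (A (A v))) + D (A (A (A v)))"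
    using assms(2,3) unfolding q_Serre_iff by (simp_all add: algebra_simps)
  show "A (A (A (B v - D v))) - q_int q 3 *s A (A (B (A v) - D (A v))) +
         q_int q 3 *s A (B (A (A v)) - D (A (A v))) - (B (A (A (A v))) - D (A (A (A v)))) = 0"
    by (simp add: lin_simps[OF assms(1)] B D scale_right_diff_distrib algebra_simps)
qed

text \<open>The condition says that the polynomial $\sum_x \kappa_x z^x$ vanishes at $z = q^{2k}$ for
$|k| \le c$. For $c = 1$ and $n = 3$ the coefficients of $(z - q^2)(z - 1)(z - q^{-2})$, which are
those of the $q$-Serre relation, satisfy it.\<close>
definition annihilates :: "'k \<Rightarrow> nat \<Rightarrow> nat \<Rightarrow> (nat \<Rightarrow> 'k) \<Rightarrow> bool" where
  "annihilates q c n \<kappa> \<longleftrightarrow>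
     (\<forall>k::int. \<bar>k\<bar> \<le> int c \<longrightarrow> (\<Sum>x\<le>n. \<kappa> x * (q powi (2 * k)) ^ x) = 0)"

text \<open>This contains all of Lusztig's higher order $q$-Serre relations, in which the coefficients are
those of $\prod_{|k| \le c} (z - q^{2k})$. Stating it for every annihilating coefficient sequence
makes it possible to choose later which exponents occur in a relation.\<close>
definition higher_q_Serre :: "'k \<Rightarrow> ('v \<Rightarrow> 'v) \<Rightarrow> ('v \<Rightarrow> 'v) \<Rightarrow> bool" where
  "higher_q_Serre q X Y \<longleftrightarrow>
     (\<forall>c n \<kappa> u. annihilates q c n \<kappa> \<longrightarrow>
        (\<Sum>x\<le>n. \<kappa> x *s (X ^^ x) ((Y ^^ c) ((X ^^ (n - x)) u))) = 0)"

abbreviation Eig :: "('v \<Rightarrow> 'v) \<Rightarrow> 'k \<Rightarrow> 'v set" where "Eig \<equiv> eigenspace scale"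

text \<open>Lagrange interpolation at the three distinct roots of a cubic that annihilates \<open>w\<close> under \<open>A\<close>.\<close>
lemma cubic_eigen_decomposition:
  assumes A: "lin A" and d: "a \<noteq> b" "b \<noteq> c" "a \<noteq> c"
    and w: "A (A (A w)) = (a + b + c) *s A (A w) - (a * b + b * c + a * c) *s A w + (a * b * c) *s w"
  shows "w \<in> span (Eig A a \<union> Eig A b \<union> Eig A c)"
proof -
  define P where "P = (\<lambda>m n. A (A w) - (m + n) *s A w + (m * n) *s w)"
  have E: "P b c \<in> Eig A a" "P a c \<in> Eig A b" "P a b \<in> Eig A c"
    unfolding eigenspace_def P_def mem_Collect_eq
    by (simp_all add: lin_simps[OF A] w scale_right_distrib scale_right_diff_distrib
        scale_left_distrib scale_left_diff_distrib algebra_simps)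
  define D where "D = (a - b) * (b - c) * (a - c)"
  have D: "D \<noteq> 0" using d by (simp add: D_def)
  define \<alpha> \<beta> \<gamma> where "\<alpha> = (b - c) / D" and "\<beta> = (c - a) / D" and "\<gamma> = (a - b) / D"
  have "\<alpha> + \<beta> + \<gamma> = 0 / D"
    by (simp only: \<alpha>_def \<beta>_def \<gamma>_def add_divide_distrib[symmetric]) simp
  moreover have "\<alpha> * (b + c) + \<beta> * (a + c) + \<gamma> * (a + b) = 0 / D"
    by (simp only: \<alpha>_def \<beta>_def \<gamma>_def times_divide_eq_left add_divide_distrib[symmetric])
       (simp add: algebra_simps)
  moreover have "\<alpha> * (b * c) + \<beta> * (a * c) + \<gamma> * (a * b) = D / D"
    by (simp only: \<alpha>_def \<beta>_def \<gamma>_def times_divide_eq_left add_divide_distrib[symmetric])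
       (simp add: D_def algebra_simps)
  ultimately have s: "\<alpha> + \<beta> + \<gamma> = 0" "\<alpha> * (b + c) + \<beta> * (a + c) + \<gamma> * (a + b) = 0"
    "\<alpha> * (b * c) + \<beta> * (a * c) + \<gamma> * (a * b) = 1"
    using D by simp_all
  have "\<alpha> *s P b c + \<beta> *s P a c + \<gamma> *s P a b
      = (\<alpha> + \<beta> + \<gamma>) *s A (A w) - (\<alpha> * (b + c) + \<beta> * (a + c) + \<gamma> * (a + b)) *s A w
        + (\<alpha> * (b * c) + \<beta> * (a * c) + \<gamma> * (a * b)) *s w"
    by (simp add: P_def scale_right_distrib scale_right_diff_distrib
        scale_left_distrib scale_left_diff_distrib algebra_simps)
  then have "w = \<alpha> *s P b c + \<beta> *s P a c + \<gamma> *s P a b" unfolding s by simp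
  moreover have "\<alpha> *s P b c + \<beta> *s P a c + \<gamma> *s P a b \<in> span (Eig A a \<union> Eig A b \<union> Eig A c)"
    using E by (intro span_add span_scale) (auto intro: span_base)
  ultimately show ?thesis by simp
qed

text \<open>Applied to an eigenvector \<open>u\<close> of \<open>A\<close>, the $q$-Serre relation reads
$(A - \mu q^2)(A - \mu)(A - \mu q^{-2}) B u = 0$, and the three roots are distinct.\<close>
lemma q_Serre_Eig:
  assumes A: "lin A" and B: "lin B" and q: "q \<noteq> 0" "q ^ 2 \<noteq> 1" "q ^ 4 \<noteq> 1" and S: "q_Serre scale q A B"
    and mu: "\<mu> \<noteq> 0" and u: "u \<in> Eig A \<mu>"
  shows "B u \<in> span (Eig A (\<mu> * q ^ 2) \<union> Eig A \<mu> \<union> Eig A (\<mu> * inverse (q ^ 2)))"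
proof -
  define t c where "t = q ^ 2" and "c = q_int q 3"
  have tc: "c * t = t ^ 2 + t + 1" using q_int_3[OF q(1,2)] by (simp add: t_def c_def)
  have t: "t \<noteq> 0" "t \<noteq> 1" "t * t \<noteq> 1"
    using q by (auto simp: t_def simp flip: power_mult power2_eq_square)
  have c: "c = t + 1 + inverse t" using tc t by (simp add: field_simps power2_eq_square)
  have Au: "A u = \<mu> *s u" using u by (simp add: eigenspace_def)
  have e: "\<mu> * t + \<mu> + \<mu> * inverse t = \<mu> * c"
    "\<mu> * t * \<mu> + \<mu> * (\<mu> * inverse t) + \<mu> * t * (\<mu> * inverse t) = \<mu>^2 * c"
    "\<mu> * t * \<mu> * (\<mu> * inverse t) = \<mu>^3"
    using t by (simp_all add: c power2_eq_square power3_eq_cube field_simps)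
  have d: "\<mu> * t \<noteq> \<mu>" "\<mu> \<noteq> \<mu> * inverse t" "\<mu> * t \<noteq> \<mu> * inverse t"
    using t mu by (auto simp: field_simps)
  have "A (A (A (B u))) = (\<mu> * c) *s A (A (B u)) - (\<mu>^2 * c) *s A (B u) + (\<mu>^3) *s B u"
    using S[unfolded q_Serre_iff, rule_format, of u]
    by (simp add: Au lin_simps[OF A] lin_simps[OF B] c_def power2_eq_square power3_eq_cube algebra_simps)
  then show ?thesis
    unfolding t_def[symmetric] by (intro cubic_eigen_decomposition[OF A d]) (simp only: e)
qed

lemma powi_double_succ: "q \<noteq> 0 \<Longrightarrow> q powi (2 * (k + 1)) = q powi (2 * k) * q ^ 2" for q :: "'f::field"
  using power_int_add[of q "2 * k" 2] by (simp add: distrib_left)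

lemma powi_double_pred:
  "q \<noteq> 0 \<Longrightarrow> q powi (2 * (k - 1)) = q powi (2 * k) * inverse (q ^ 2)" for q :: "'f::field"
  using power_int_diff[of q "2 * k" 2] by (simp add: right_diff_distrib divide_inverse)

lemma q_Serre_Eig_funpow:
  assumes A: "lin A" and B: "lin B" and q: "q \<noteq> 0" "q ^ 2 \<noteq> 1" "q ^ 4 \<noteq> 1" and S: "q_Serre scale q A B"
    and mu: "\<mu> \<noteq> 0" and u: "u \<in> Eig A \<mu>"
  shows "(B ^^ c) u \<in> span (\<Union>k\<in>{- int c..int c}. Eig A (\<mu> * q powi (2 * k)))"
proof (induction c)
  case 0
  then show ?case using u by (auto intro: span_base)
next
  case (Suc c)
  show ?case unfolding funpow.simps o_apply
  proof (rule lin_span_into[OF B subspace_span _ Suc])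
    fix x assume "x \<in> (\<Union>k\<in>{- int c..int c}. Eig A (\<mu> * q powi (2 * k)))"
    then obtain k where "k \<in> {- int c..int c}" and x: "x \<in> Eig A (\<mu> * q powi (2 * k))" by blast
    then have k: "\<bar>k\<bar> \<le> int c" by auto
    have e: "\<mu> * q powi (2 * k) * q ^ 2 = \<mu> * q powi (2 * (k + 1))"
      "\<mu> * q powi (2 * k) * inverse (q ^ 2) = \<mu> * q powi (2 * (k - 1))"
      using powi_double_succ[OF q(1), of k] powi_double_pred[OF q(1), of k] by simp_all
    have "B x \<in> span (Eig A (\<mu> * q powi (2 * (k + 1))) \<union> Eig A (\<mu> * q powi (2 * k)) \<union> Eig A (\<mu> * q powi (2 * (k - 1))))"
      using q_Serre_Eig[OF A B q S _ x] mu q(1) unfolding e by simp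
    also have "\<dots> \<subseteq> span (\<Union>k\<in>{- int (Suc c)..int (Suc c)}. Eig A (\<mu> * q powi (2 * k)))"
    proof (rule span_mono)
      have "k + 1 \<in> {- int (Suc c)..int (Suc c)}" "k \<in> {- int (Suc c)..int (Suc c)}" "k - 1 \<in> {- int (Suc c)..int (Suc c)}"
        using k by auto
      then show "Eig A (\<mu> * q powi (2 * (k + 1))) \<union> Eig A (\<mu> * q powi (2 * k)) \<union> Eig A (\<mu> * q powi (2 * (k - 1)))
        \<subseteq> (\<Union>k\<in>{- int (Suc c)..int (Suc c)}. Eig A (\<mu> * q powi (2 * k)))" by blast
    qed
    finally show "B x \<in> span (\<Union>k\<in>{- int (Suc c)..int (Suc c)}. Eig A (\<mu> * q powi (2 * k)))" .
  qed
qed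

lemma Eig_funpow: "lin A \<Longrightarrow> u \<in> Eig A \<mu> \<Longrightarrow> (A ^^ n) u = \<mu> ^ n *s u"
  by (induction n) (auto simp: eigenspace_def lin_simps mult.commute)

text \<open>If \<open>u\<close> has \<open>A\<close>-eigenvalue $\mu$, then $B^c u$ is a sum of eigenvectors $w$ for eigenvalues
$\mu q^{2k}$ with $|k| \le c$, and on such a $w$ the sum $\sum_x \kappa_x \mu^{n-x} A^x w$ is
$\mu^n \sum_x \kappa_x q^{2kx} w = 0$. The operator \<open>A\<close> has to be invertible for the roots
$\mu q^{2k}$ to be distinct, so this argument does not apply to nilpotent operators directly.\<close>
lemma higher_q_Serre_if_diagonalizable:
  assumes A: "lin A" and B: "lin B" and q: "q \<noteq> 0" "q ^ 2 \<noteq> 1" "q ^ 4 \<noteq> 1" and S: "q_Serre scale q A B"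
    and diag: "diagonalizable scale A" and nz: "0 \<notin> eigenvalues scale A"
  shows "higher_q_Serre q A B"
  unfolding higher_q_Serre_def
proof (intro allI impI)
  fix c n \<kappa> u
  assume ann: "annihilates q c n \<kappa>"
  let ?T = "\<lambda>u. \<Sum>x\<le>n. \<kappa> x *s (A ^^ x) ((B ^^ c) ((A ^^ (n - x)) u))"
  have "lin ?T" 
    by (intro lin_lin_comb lin_compose[OF lin_funpow[OF A] lin_compose[OF lin_funpow[OF B] lin_funpow[OF A]]])
  moreover have "u \<in> span (\<Union> (eigenspaces scale A))" using diag by (simp add: diagonalizable_def)
  moreover have "?T u = 0" if u: "u \<in> \<Union> (eigenspaces scale A)" for u
  proof -
    from u obtain \<mu> where ev: "\<mu> \<in> eigenvalues scale A" and u: "u \<in> Eig A \<mu>"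
      by (auto simp: eigenspaces_def)
    have mu: "\<mu> \<noteq> 0" using nz ev by blast
    define w where "w = (B ^^ c) u"
    have w: "w \<in> span (\<Union>k\<in>{- int c..int c}. Eig A (\<mu> * q powi (2 * k)))"
      unfolding w_def by (rule q_Serre_Eig_funpow[OF A B q S mu u])
    have T: "?T u = (\<Sum>x\<le>n. (\<kappa> x * \<mu> ^ (n - x)) *s (A ^^ x) w)"
      by (simp add: Eig_funpow[OF A u] w_def lin_simps[OF lin_funpow[OF A]] lin_simps[OF lin_funpow[OF B]])
    have "(\<Sum>x\<le>n. (\<kappa> x * \<mu> ^ (n - x)) *s (A ^^ x) w) = 0"
    proof (rule lin_zero_on_span[where f = "\<lambda>w. \<Sum>x\<le>n. (\<kappa> x * \<mu> ^ (n - x)) *s (A ^^ x) w", OF _ _ w])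
      show "lin (\<lambda>w. \<Sum>x\<le>n. (\<kappa> x * \<mu> ^ (n - x)) *s (A ^^ x) w)"
        by (intro lin_lin_comb lin_funpow A)
    next
      fix w assume "w \<in> (\<Union>k\<in>{- int c..int c}. Eig A (\<mu> * q powi (2 * k)))"
      then obtain k where "k \<in> {- int c..int c}" and w: "w \<in> Eig A (\<mu> * q powi (2 * k))" by blast
      then have k: "\<bar>k\<bar> \<le> int c" by auto
      have "(\<Sum>x\<le>n. (\<kappa> x * \<mu> ^ (n - x)) *s (A ^^ x) w)
          = (\<Sum>x\<le>n. (\<mu> ^ n * (\<kappa> x * (q powi (2 * k)) ^ x)) *s w)"
      proof (rule sum.cong[OF refl])
        fix x assume "x \<in> {..n}"
        then have "\<mu> ^ n = \<mu> ^ (n - x) * \<mu> ^ x" by (simp flip: power_add)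
        then show "(\<kappa> x * \<mu> ^ (n - x)) *s (A ^^ x) w = (\<mu> ^ n * (\<kappa> x * (q powi (2 * k)) ^ x)) *s w"
          by (simp add: Eig_funpow[OF A w] power_mult_distrib mult_ac)
      qed
      also have "\<dots> = (\<mu> ^ n * (\<Sum>x\<le>n. \<kappa> x * (q powi (2 * k)) ^ x)) *s w"
        by (simp add: scale_sum_left sum_distrib_left)
      also have "\<dots> = 0" using ann k by (simp add: annihilates_def)
      finally show "(\<Sum>x\<le>n. (\<kappa> x * \<mu> ^ (n - x)) *s (A ^^ x) w) = 0" .
    qed
    then show ?thesis using T by simp
  qed
  ultimately show "?T u = 0" using lin_zero_on_span[of ?T "\<Union> (eigenspaces scale A)" u] by blast
qed

text \<open>A homogeneous relation for \<open>(A, L)\<close> passes to the part \<open>R\<close> of \<open>A\<close> of highest degree: on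
\<open>G j\<close> the operators $A^x L^c A^{n-x}$ and $R^x L^c R^{n-x}$ agree up to terms in degrees below
$j + n - c$. Hence the relation for \<open>(R, L)\<close> produces a vector that lies both in degree
$j + n - c$ and in the sum of the lower degrees.\<close>
lemma higher_q_Serre_leading_part:
  fixes G :: "int \<Rightarrow> 'v set"
  assumes A: "lin A" and R: "lin R" and L: "lin L"
    and G: "\<And>j. subspace (G j)"
    and R_G: "\<And>j u. u \<in> G j \<Longrightarrow> R u \<in> G (j + 1)"
    and L_G: "\<And>j u. u \<in> G j \<Longrightarrow> L u \<in> G (j - 1)"
    and A_R: "\<And>j u. u \<in> G j \<Longrightarrow> A u - R u \<in> G j"
    and spanning: "span (\<Union>j. G j) = UNIV"
    and indep: "\<And>j u. u \<in> G j \<Longrightarrow> u \<in> span (\<Union>h\<in>{..<j}. G h) \<Longrightarrow> u = 0"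
    and higher: "higher_q_Serre q A L"
  shows "higher_q_Serre q R L"
proof -
  define W where "W = (\<lambda>j. span (\<Union>h\<in>{..<j}. G h))"
  have W: "subspace (W j)" for j by (simp add: W_def)
  have G_W: "u \<in> W j" if "u \<in> G h" "h < j" for u h j
    using that by (auto simp: W_def intro: span_base)
  have A_W: "A u \<in> W (j + 1)" if "u \<in> W j" for u j
  proof (rule lin_span_into[OF A W _ that[unfolded W_def]])
    fix x assume "x \<in> (\<Union>h\<in>{..<j}. G h)"
    then obtain h where h: "h < j" "x \<in> G h" by blast
    have "(A x - R x) + R x \<in> W (j + 1)"
      using h by (intro subspace_add[OF W] G_W[OF A_R] G_W[OF R_G]) auto
    then show "A x \<in> W (j + 1)" by simp
  qed
  have L_W: "L u \<in> W (j - 1)" if "u \<in> W j" for u j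
  proof (rule lin_span_into[OF L W _ that[unfolded W_def]])
    fix x assume "x \<in> (\<Union>h\<in>{..<j}. G h)"
    then obtain h where h: "h < j" "x \<in> G h" by blast
    then show "L x \<in> W (j - 1)" by (intro G_W[OF L_G]) auto
  qed
  have A_pow_W: "(A ^^ n) u \<in> W (j + int n)" if "u \<in> W j" for u j n
  proof (induction n)
    case (Suc n)
    then show ?case using A_W[OF Suc] by (simp add: ac_simps)
  qed (use that in simp)
  have L_pow_W: "(L ^^ n) u \<in> W (j - int n)" if "u \<in> W j" for u j n
  proof (induction n)
    case (Suc n)
    then show ?case using L_W[OF Suc] by (simp add: algebra_simps)
  qed (use that in simp)
  have R_pow_G: "(R ^^ n) u \<in> G (j + int n)" if "u \<in> G j" for u j n
  proof (induction n)
    case (Suc n)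
    then show ?case using R_G[OF Suc] by (simp add: ac_simps)
  qed (use that in simp)
  have L_pow_G: "(L ^^ n) u \<in> G (j - int n)" if "u \<in> G j" for u j n
  proof (induction n)
    case (Suc n)
    then show ?case using L_G[OF Suc] by (simp add: algebra_simps)
  qed (use that in simp)
  have diff: "(A ^^ n) u - (R ^^ n) u \<in> W (j + int n)" if u: "u \<in> G j" for u j n
  proof (induction n)
    case 0
    show ?case using subspace_0[OF W] by simp
  next
    case (Suc n)
    have eq: "(A ^^ Suc n) u - (R ^^ Suc n) u
        = A ((A ^^ n) u - (R ^^ n) u) + (A ((R ^^ n) u) - R ((R ^^ n) u))"
      by (simp add: lin_simps[OF A])
    have "A ((A ^^ n) u - (R ^^ n) u) \<in> W (j + int (Suc n))"
      using A_W[OF Suc] by (simp add: ac_simps)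
    moreover have "A ((R ^^ n) u) - R ((R ^^ n) u) \<in> W (j + int (Suc n))"
      by (rule G_W[OF A_R[OF R_pow_G[OF u]]]) simp
    ultimately show ?case unfolding eq by (intro subspace_add[OF W])
  qed
  show ?thesis
    unfolding higher_q_Serre_def
  proof (intro allI impI)
    fix c n \<kappa> u
    assume ann: "annihilates q c n \<kappa>"
    let ?T = "\<lambda>u. \<Sum>x\<le>n. \<kappa> x *s (R ^^ x) ((L ^^ c) ((R ^^ (n - x)) u))"
    have lin: "lin ?T"
      by (intro lin_lin_comb lin_compose[OF lin_funpow[OF R] lin_compose[OF lin_funpow[OF L] lin_funpow[OF R]]])
    have "?T u = 0" if "u \<in> (\<Union>j. G j)" for u
    proof -
      from that obtain j where u: "u \<in> G j" by blast
      let ?m = "j + int n - int c"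
      have "(A ^^ x) ((L ^^ c) ((A ^^ (n - x)) u)) - (R ^^ x) ((L ^^ c) ((R ^^ (n - x)) u)) \<in> W ?m"
        if x: "x \<le> n" for x
      proof -
        have "(A ^^ x) ((L ^^ c) ((A ^^ (n - x)) u - (R ^^ (n - x)) u)) \<in> W ?m"
          using A_pow_W[OF L_pow_W[OF diff[OF u, of "n - x"], of c], of x] x by (simp add: of_nat_diff algebra_simps)
        moreover have "(A ^^ x) ((L ^^ c) ((R ^^ (n - x)) u)) - (R ^^ x) ((L ^^ c) ((R ^^ (n - x)) u)) \<in> W ?m"
          using diff[OF L_pow_G[OF R_pow_G[OF u, of "n - x"], of c], of x] x by (simp add: of_nat_diff algebra_simps)
        ultimately have "(A ^^ x) ((L ^^ c) ((A ^^ (n - x)) u - (R ^^ (n - x)) u)) +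
          ((A ^^ x) ((L ^^ c) ((R ^^ (n - x)) u)) - (R ^^ x) ((L ^^ c) ((R ^^ (n - x)) u))) \<in> W ?m"
          by (rule subspace_add[OF W])
        then show ?thesis by (simp add: lin_simps[OF lin_funpow[OF A]] lin_simps[OF lin_funpow[OF L]])
      qed
      then have "(\<Sum>x\<le>n. \<kappa> x *s ((A ^^ x) ((L ^^ c) ((A ^^ (n - x)) u))
          - (R ^^ x) ((L ^^ c) ((R ^^ (n - x)) u)))) \<in> W ?m"
        by (intro subspace_sum[OF W] subspace_scale[OF W]) simp
      also have "(\<Sum>x\<le>n. \<kappa> x *s ((A ^^ x) ((L ^^ c) ((A ^^ (n - x)) u))
          - (R ^^ x) ((L ^^ c) ((R ^^ (n - x)) u))))
        = (\<Sum>x\<le>n. \<kappa> x *s (A ^^ x) ((L ^^ c) ((A ^^ (n - x)) u))) - ?T u"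
        by (simp add: scale_right_diff_distrib sum_subtractf)
      also have "(\<Sum>x\<le>n. \<kappa> x *s (A ^^ x) ((L ^^ c) ((A ^^ (n - x)) u))) = 0"
        using higher ann unfolding higher_q_Serre_def by blast
      finally have "- (0 - ?T u) \<in> W ?m" by (rule subspace_neg[OF W])
      then have "?T u \<in> span (\<Union>h\<in>{..<?m}. G h)" by (simp add: W_def)
      moreover have "?T u \<in> G ?m"
      proof (intro subspace_sum[OF G] subspace_scale[OF G])
        fix x assume x: "x \<in> {..n}"
        show "(R ^^ x) ((L ^^ c) ((R ^^ (n - x)) u)) \<in> G ?m"
          using R_pow_G[OF L_pow_G[OF R_pow_G[OF u, of "n - x"], of c], of x] x
          by (simp add: of_nat_diff algebra_simps)
      qed
      ultimately show ?thesis using indep by blast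
    qed
    then show "?T u = 0" using lin_zero_on_span[OF lin, of "\<Union>j. G j" u] spanning by blast
  qed
qed

lemma higher_q_Serre_zero: "higher_q_Serre q (\<lambda>_. 0) (\<lambda>_. 0)"
  unfolding higher_q_Serre_def
proof (intro allI impI)
  fix c n \<kappa> u
  assume ann: "annihilates q c n \<kappa>"
  let ?Z = "\<lambda>_::'v. 0::'v"
  have Z: "(?Z ^^ m) w = (if m = 0 then w else 0)" for m w by (induction m) auto
  show "(\<Sum>x\<le>n. \<kappa> x *s (?Z ^^ x) ((?Z ^^ c) ((?Z ^^ (n - x)) u))) = 0"
  proof (cases "n = 0 \<and> c = 0")
    case True
    then have "\<kappa> 0 = 0" using ann[unfolded annihilates_def, rule_format, of 0] by simp
    then show ?thesis using True by simp
  next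
    case False
    then show ?thesis by (intro sum.neutral) (auto simp: Z)
  qed
qed

end

section \<open>Exchanging exponents in $X^b Y^c X^{n-b}$\<close>

text \<open>The row of \<open>b\<close> in the matrix with entries $q^{2kx}$, $|k| \le c$, is a combination of the rows
of any \<open>2 c + 1\<close> exponents \<open>x\<close>. This holds because, after shifting \<open>k\<close> by \<open>c\<close>, the matrix is a
Vandermonde matrix with nodes $q^{2x}$, which are distinct when \<open>q\<close> is not a root of unity. The
coefficients are the values at $q^{2b}$ of the Lagrange basis polynomials, corrected for the shift.\<close>
lemma dual_lagrange_interpolation:
  fixes q :: "'f::field"
  assumes q: "q \<noteq> 0" "\<And>n. 0 < n \<Longrightarrow> q ^ n \<noteq> 1" and S: "finite S" "card S = 2 * c + 1"
  shows "\<exists>\<kappa>. \<forall>k::int. \<bar>k\<bar> \<le> int c \<longrightarrow> (\<Sum>x\<in>S. \<kappa> x * (q powi (2 * k)) ^ x) = (q powi (2 * k)) ^ b"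
proof -
  define m where "m = (\<lambda>x. (q ^ 2) ^ x)"
  have inj: "inj m"
  proof (rule linorder_injI)
    fix x y :: nat assume "x < y"
    then have "2 * y = 2 * x + 2 * (y - x)" by simp
    then have "m y = m x * q ^ (2 * (y - x))"
      unfolding m_def power_mult[symmetric] power_add[symmetric] by (rule arg_cong)
    moreover have "q ^ (2 * (y - x)) \<noteq> 1" using q(2) \<open>x < y\<close> by simp
    ultimately show "m x \<noteq> m y" using q(1) by (simp add: m_def)
  qed
  define l where "l = (\<lambda>s. \<Prod>t\<in>S - {s}. smult (inverse (m s - m t)) [:- m t, 1:])"
  have deg: "degree (l s) \<le> 2 * c" if "s \<in> S" for s
  proof -
    have "degree (l s) \<le> (\<Sum>t\<in>S - {s}. degree (smult (inverse (m s - m t)) [:- m t, 1:]))"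
      unfolding l_def by (rule degree_prod_sum_le[unfolded o_def]) (use S(1) in simp)
    also have "\<dots> \<le> (\<Sum>t\<in>S - {s}. 1)"
      by (intro sum_mono order_trans[OF degree_smult_le]) simp
    also have "\<dots> = 2 * c" using S that by simp
    finally show ?thesis .
  qed
  have val: "poly (l s) (m x) = (if x = s then 1 else 0)" if "s \<in> S" "x \<in> S" for s x
  proof (cases "x = s")
    case True
    have "poly (l s) (m s) = (\<Prod>t\<in>S - {s}. 1)"
      unfolding l_def poly_prod
    proof (intro prod.cong refl)
      fix t assume t: "t \<in> S - {s}"
      have "m s - m t \<noteq> 0" using t injD[OF inj, of s t] by auto
      then have "inverse (m s - m t) * (m s - m t) = 1" by simp
      then show "poly (smult (inverse (m s - m t)) [:- m t, 1:]) (m s) = 1"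
        by (simp add: algebra_simps)
    qed
    then show ?thesis using True by simp
  next
    case False
    then show ?thesis unfolding l_def poly_prod using that S(1) by (auto intro!: prod_zero)
  qed
  have interp: "(\<Sum>s\<in>S. m s ^ j * poly (l s) (m b)) = m b ^ j" if "j \<le> 2 * c" for j
  proof -
    have "(\<Sum>s\<in>S. smult (m s ^ j) (l s)) = monom 1 j"
    proof (rule poly_eqI_degree[where A = "m ` S"])
      show "poly (\<Sum>s\<in>S. smult (m s ^ j) (l s)) y = poly (monom 1 j) y" if "y \<in> m ` S" for y
      proof -
        from that obtain x where x: "x \<in> S" "y = m x" by blast
        have "poly (\<Sum>s\<in>S. smult (m s ^ j) (l s)) y = (\<Sum>s\<in>S. if x = s then m s ^ j else 0)"
          unfolding poly_sum by (intro sum.cong) (auto simp: val x)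
        then show ?thesis using x S(1) by (simp add: poly_monom)
      qed
      have card: "card (m ` S) = 2 * c + 1" using inj S by (simp add: card_image inj_on_subset)
      have "degree (\<Sum>s\<in>S. smult (m s ^ j) (l s)) \<le> 2 * c"
        using deg by (intro degree_sum_le S(1)) (auto intro: order_trans[OF degree_smult_le])
      then show "degree (\<Sum>s\<in>S. smult (m s ^ j) (l s)) < card (m ` S)" by (simp add: card)
      show "degree (monom (1::'f) j) < card (m ` S)" using that by (simp add: card degree_monom_eq)
    qed
    then have "poly (\<Sum>s\<in>S. smult (m s ^ j) (l s)) (m b) = m b ^ j" by (simp add: poly_monom)
    then show ?thesis by (simp add: poly_sum)
  qed
  (* Multiplying by m x ^ c moves the range -c..c of k to 0..2c, where interpolation applies. *)
  have shift: "m x ^ nat (k + int c) = m x ^ c * (q powi (2 * k)) ^ x" if "\<bar>k\<bar> \<le> int c" for k x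
  proof -
    have "m x ^ nat (k + int c) = q powi (int (2 * x * nat (k + int c)))"
      unfolding m_def power_int_of_nat power_mult ..
    also have "int (2 * x * nat (k + int c)) = int (2 * x * c) + 2 * k * int x"
      using that by (simp add: algebra_simps)
    also have "q powi \<dots> = q powi int (2 * x * c) * (q powi (2 * k)) powi int x"
      unfolding power_int_mult[symmetric] by (rule power_int_add) (simp add: q(1))
    also have "\<dots> = m x ^ c * (q powi (2 * k)) ^ x"
      unfolding m_def power_int_of_nat power_mult ..
    finally show ?thesis .
  qed
  define \<kappa> where "\<kappa> = (\<lambda>s. poly (l s) (m b) * m s ^ c / m b ^ c)"
  have "(\<Sum>x\<in>S. \<kappa> x * (q powi (2 * k)) ^ x) = (q powi (2 * k)) ^ b" if k: "\<bar>k\<bar> \<le> int c" for k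
  proof -
    have "(\<Sum>x\<in>S. \<kappa> x * (q powi (2 * k)) ^ x)
        = (\<Sum>x\<in>S. m x ^ nat (k + int c) * poly (l x) (m b)) / m b ^ c"
      unfolding shift[OF k] sum_divide_distrib \<kappa>_def by (intro sum.cong) (auto simp: mult_ac)
    also have "\<dots> = m b ^ nat (k + int c) / m b ^ c"
      using k by (subst interp) auto
    also have "\<dots> = (q powi (2 * k)) ^ b"
      unfolding shift[OF k] using q(1) by (simp add: m_def)
    finally show ?thesis .
  qed
  then show ?thesis by blast
qed

lemma sum_atMost_reflect: "(\<Sum>x\<le>n. f (n - x)) = (\<Sum>x\<le>n. f x)" for f :: "nat \<Rightarrow> 'b::comm_monoid_add"
  by (rule sum.reindex_bij_witness[where i = "\<lambda>x. n - x" and j = "\<lambda>x. n - x"]) auto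

context endomorphisms
begin

lemma annihilates_reflect:
  assumes q: "q \<noteq> 0" and ann: "annihilates q c n \<kappa>"
  shows "annihilates q c n (\<lambda>x. \<kappa> (n - x))"
  unfolding annihilates_def
proof (intro allI impI)
  fix k :: int assume k: "\<bar>k\<bar> \<le> int c"
  have "(\<Sum>x\<le>n. \<kappa> (n - x) * (q powi (2 * k)) ^ x)
      = (\<Sum>x\<le>n. \<kappa> (n - x) * (q powi (2 * k)) ^ (n - (n - x)))" by (intro sum.cong) auto
  also have "\<dots> = (\<Sum>x\<le>n. \<kappa> x * (q powi (2 * k)) ^ (n - x))"
    by (rule sum_atMost_reflect)
  also have "\<dots> = (\<Sum>x\<le>n. (q powi (2 * k)) ^ n * (\<kappa> x * (q powi (2 * (- k))) ^ x))"
    using q by (intro sum.cong) (simp_all add: power_diff power_int_minus field_simps)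
  also have "\<dots> = (q powi (2 * k)) ^ n * (\<Sum>x\<le>n. \<kappa> x * (q powi (2 * (- k))) ^ x)"
    by (rule sum_distrib_left[symmetric])
  also have "\<dots> = 0" using ann k unfolding annihilates_def by (metis abs_minus mult_zero_right)
  finally show "(\<Sum>x\<le>n. \<kappa> (n - x) * (q powi (2 * k)) ^ x) = 0" .
qed

text \<open>Among the operators $X^x Y^c X^{n-x}$ with $0 \le x \le n$, any \<open>2 c + 1\<close> span all the others.
The same coefficients serve for the reversed products with \<open>X\<close> and \<open>Y\<close> interchanged, because the
annihilation condition is invariant under $x \mapsto n - x$. This second half is what makes the
symmetry of \<open>level_zero_symmetry\<close> provable.\<close>
lemma exchange:
  assumes q: "q \<noteq> 0" "\<And>n. 0 < n \<Longrightarrow> q ^ n \<noteq> 1"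
    and XY: "higher_q_Serre q X Y" and YX: "higher_q_Serre q Y X"
    and S: "S \<subseteq> {..n}" "card S = 2 * c + 1" and b: "b \<le> n"
  obtains \<kappa> where
    "\<And>u. (X ^^ b) ((Y ^^ c) ((X ^^ (n - b)) u)) = (\<Sum>x\<in>S. \<kappa> x *s (X ^^ x) ((Y ^^ c) ((X ^^ (n - x)) u)))"
    "\<And>u. (Y ^^ (n - b)) ((X ^^ c) ((Y ^^ b) u)) = (\<Sum>x\<in>S. \<kappa> x *s (Y ^^ (n - x)) ((X ^^ c) ((Y ^^ x) u)))"
proof -
  have fS: "finite S" using S(1) finite_subset by blast
  obtain \<kappa> where \<kappa>: "\<And>k::int. \<bar>k\<bar> \<le> int c \<Longrightarrow>
      (\<Sum>x\<in>S. \<kappa> x * (q powi (2 * k)) ^ x) = (q powi (2 * k)) ^ b"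
    using dual_lagrange_interpolation[OF q fS S(2), of b] by blast
  define \<mu> where "\<mu> = (\<lambda>x. (if x \<in> S then \<kappa> x else 0) - (if x = b then 1 else 0))"
  have inter: "{..n} \<inter> S = S" using S(1) by blast
  have "annihilates q c n \<mu>"
    unfolding annihilates_def
  proof (intro allI impI)
    fix k :: int assume k: "\<bar>k\<bar> \<le> int c"
    have "(\<Sum>x\<le>n. \<mu> x * (q powi (2 * k)) ^ x)
        = (\<Sum>x\<le>n. if x \<in> S then \<kappa> x * (q powi (2 * k)) ^ x else 0)
          - (\<Sum>x\<le>n. if x = b then (q powi (2 * k)) ^ x else 0)"
      unfolding \<mu>_def sum_subtractf[symmetric] by (intro sum.cong) (auto simp: left_diff_distrib)
    also have "\<dots> = 0"
      using b \<kappa>[OF k] by (simp add: sum.delta flip: sum.inter_restrict) (simp add: inter)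
    finally show "(\<Sum>x\<le>n. \<mu> x * (q powi (2 * k)) ^ x) = 0" .
  qed
  note ann = this annihilates_reflect[OF q(1) this]
  have split: "(\<Sum>x\<le>n. \<mu> x *s f x) = (\<Sum>x\<in>S. \<kappa> x *s f x) - f b" for f
  proof -
    have "(\<Sum>x\<le>n. \<mu> x *s f x)
        = (\<Sum>x\<le>n. if x \<in> S then \<kappa> x *s f x else 0) - (\<Sum>x\<le>n. if x = b then f x else 0)"
      unfolding \<mu>_def sum_subtractf[symmetric] by (intro sum.cong) (auto simp: scale_left_diff_distrib)
    then show ?thesis
      using b by (simp add: sum.delta flip: sum.inter_restrict) (simp add: inter)
  qed
  show ?thesis
  proof
    fix u
    have "(\<Sum>x\<le>n. \<mu> x *s (X ^^ x) ((Y ^^ c) ((X ^^ (n - x)) u))) = 0"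
      using XY ann(1) unfolding higher_q_Serre_def by blast
    then show "(X ^^ b) ((Y ^^ c) ((X ^^ (n - b)) u)) = (\<Sum>x\<in>S. \<kappa> x *s (X ^^ x) ((Y ^^ c) ((X ^^ (n - x)) u)))"
      unfolding split by simp
    have "(\<Sum>x\<le>n. \<mu> x *s (Y ^^ (n - x)) ((X ^^ c) ((Y ^^ x) u)))
        = (\<Sum>x\<le>n. \<mu> (n - x) *s (Y ^^ (n - (n - x))) ((X ^^ c) ((Y ^^ (n - x)) u)))"
      by (rule sum_atMost_reflect[symmetric])
    also have "\<dots> = (\<Sum>x\<le>n. \<mu> (n - x) *s (Y ^^ x) ((X ^^ c) ((Y ^^ (n - x)) u)))"
      by (intro sum.cong) auto
    also have "\<dots> = 0" using YX ann(2) unfolding higher_q_Serre_def by blast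
    finally show "(Y ^^ (n - b)) ((X ^^ c) ((Y ^^ b) u)) = (\<Sum>x\<in>S. \<kappa> x *s (Y ^^ (n - x)) ((X ^^ c) ((Y ^^ x) u)))"
      unfolding split by simp
  qed
qed

end

section \<open>Raising and lowering operators on a graded space\<close>

lemma alt_word_append:
  "alt_word (xs @ ys) L R v =
     alt_word xs L R (if even (length xs) then alt_word ys L R v else alt_word ys R L v)"
  by (induction xs arbitrary: L R) auto

text \<open>The grading is indexed by integers, with zero pieces outside \<open>0..d\<close>, so that no case distinction
is needed when a word leaves this range.\<close>
locale raising_lowering = endomorphisms scale
  for scale :: "'k::field \<Rightarrow> 'v::ab_group_add \<Rightarrow> 'v" (infixr "*s" 75) +
  fixes q :: 'k and R L :: "'v \<Rightarrow> 'v" and G :: "int \<Rightarrow> 'v set" and d :: nat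
  assumes q_nonzero: "q \<noteq> 0" and q_power: "0 < n \<Longrightarrow> q ^ n \<noteq> 1"
    and lin_R: "lin R" and lin_L: "lin L"
    and subspace_G: "subspace (G j)"
    and R_G: "u \<in> G j \<Longrightarrow> R u \<in> G (j + 1)"
    and L_G: "u \<in> G j \<Longrightarrow> L u \<in> G (j - 1)"
    and G_negative: "j < 0 \<Longrightarrow> G j = {0}"
    and G_large: "int d < j \<Longrightarrow> G j = {0}"
    and higher_RL: "higher_q_Serre q R L"
    and higher_LR: "higher_q_Serre q L R"
begin

lemma R_funpow_G: "u \<in> G j \<Longrightarrow> (R ^^ n) u \<in> G (j + int n)"
proof (induction n)
  case (Suc n)
  then show ?case using R_G[of "(R ^^ n) u" "j + int n"] by (simp add: ac_simps)
qed simp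

lemma L_funpow_G: "u \<in> G j \<Longrightarrow> (L ^^ n) u \<in> G (j - int n)"
proof (induction n)
  case (Suc n)
  then show ?case using L_G[of "(L ^^ n) u" "j - int n"] by (simp add: algebra_simps)
qed simp

lemmas R_simps = lin_simps[OF lin_funpow[OF lin_R]] lin_simps[OF lin_R]
lemmas L_simps = lin_simps[OF lin_funpow[OF lin_L]] lin_simps[OF lin_L]

lemma L_R_vanish:
  assumes "v \<in> G 0" "b < a" shows "(L ^^ a) ((R ^^ b) v) = 0"
proof -
  have "(L ^^ a) ((R ^^ b) v) \<in> G (int b - int a)"
    using L_funpow_G[OF R_funpow_G[OF assms(1), of b], of a] by simp
  then show ?thesis using G_negative assms(2) by auto
qed

text \<open>Both sides are exchanged by the antiautomorphism that reverses words and swaps \<open>R\<close> and \<open>L\<close>. If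
$b > c$, rewrite $R^b L^c R^{n-b}$ on the left-hand side, and by the same coefficients
$L^{n-b} R^c L^b$ on the right-hand side, in terms of the exponents $x \le c$ or $x > n - c$. The
words with $x > n - c$ kill \<open>v\<close> because they descend below degree 0, and for $x \le c$ the sum
$x + c$ is smaller than $b + c$.\<close>
lemma level_zero_symmetry:
  assumes v: "v \<in> G 0" and "b \<le> n" "c \<le> n"
  shows "(L ^^ (n - c)) ((R ^^ b) ((L ^^ c) ((R ^^ (n - b)) v)))
       = (L ^^ (n - b)) ((R ^^ c) ((L ^^ b) ((R ^^ (n - c)) v)))"
proof -
  define \<Phi> where "\<Phi> = (\<lambda>b c. (L ^^ (n - c)) ((R ^^ b) ((L ^^ c) ((R ^^ (n - b)) v))))"
  have zero: "\<Phi> b c = 0" if "b \<le> n" "n < b + c" for b c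
    using L_R_vanish[OF v, of "n - b" c] that by (simp add: \<Phi>_def R_simps L_simps)
  have "\<Phi> b c = \<Phi> c b" if "b \<le> n" "c \<le> n" for b c
    using that
  proof (induction "b + c" arbitrary: b c rule: less_induct)
    case less
    have key: "\<Phi> b' c' = \<Phi> c' b'" if bc: "c' < b'" "b' \<le> n" "b' + c' = b + c" for b' c'
    proof (cases "n < b' + c'")
      case True
      then show ?thesis using zero[of b' c'] zero[of c' b'] bc by simp
    next
      case False
      let ?S = "{..c'} \<union> {n - c' <.. n}"
      have S: "?S \<subseteq> {..n}" "card ?S = 2 * c' + 1"
        using False bc by (auto, subst card_Un_disjoint) auto
      obtain \<kappa> where
        \<kappa>: "\<And>u. (R ^^ b') ((L ^^ c') ((R ^^ (n - b')) u)) = (\<Sum>x\<in>?S. \<kappa> x *s (R ^^ x) ((L ^^ c') ((R ^^ (n - x)) u)))"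
        "\<And>u. (L ^^ (n - b')) ((R ^^ c') ((L ^^ b') u)) = (\<Sum>x\<in>?S. \<kappa> x *s (L ^^ (n - x)) ((R ^^ c') ((L ^^ x) u)))"
        using exchange[OF q_nonzero q_power higher_RL higher_LR S bc(2)] by blast
      have "\<Phi> b' c' = (\<Sum>x\<in>?S. \<kappa> x *s \<Phi> x c')"
        unfolding \<Phi>_def \<kappa>(1) by (simp add: L_simps)
      also have "\<dots> = (\<Sum>x\<in>?S. \<kappa> x *s \<Phi> c' x)"
      proof (rule sum.cong[OF refl])
        fix x assume x: "x \<in> ?S"
        show "\<kappa> x *s \<Phi> x c' = \<kappa> x *s \<Phi> c' x"
        proof (cases "x \<le> c'")
          case True
          then show ?thesis using less.hyps[of x c'] bc by simp
        next
          case False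
          then have "n < x + c'" "x \<le> n" using x by auto
          then show ?thesis using zero[of x c'] zero[of c' x] bc by simp
        qed
      qed
      also have "\<dots> = \<Phi> c' b'" unfolding \<Phi>_def \<kappa>(2) ..
      finally show ?thesis .
    qed
    show ?case
      using key[of c b] key[of b c] less.prems by (cases b c rule: linorder_cases) auto
  qed
  then show ?thesis using assms unfolding \<Phi>_def by blast
qed

text \<open>The case \<open>b = i\<close>, \<open>c = j\<close>, \<open>n = i + j\<close> of the symmetry. This is what gives the operators
$L^n R^n$ on degree 0 a common eigenvector.\<close>
lemma L_R_commute:
  assumes "v \<in> G 0"
  shows "(L ^^ i) ((R ^^ i) ((L ^^ j) ((R ^^ j) v))) = (L ^^ j) ((R ^^ j) ((L ^^ i) ((R ^^ i) v)))"
  using level_zero_symmetry[OF assms, of i "i + j" j] by simp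

end

section \<open>Straightening words to increasing exponents\<close>

text \<open>Straightening replaces three adjacent exponents \<open>a\<close>, \<open>b\<close>, \<open>c\<close> by \<open>x\<close>, \<open>b\<close>, \<open>y\<close> with
\<open>x + y = a + c\<close> and \<open>b\<close> small. Such a step spreads the outer exponents further apart, so the second
elementary symmetric function of the exponents decreases, except when the outer exponents are
merely swapped. The sum of the exponents weighted by their positions takes care of that case.\<close>
primrec pair_products :: "nat list \<Rightarrow> nat" where
  "pair_products [] = 0"
| "pair_products (x # xs) = x * sum_list xs + pair_products xs"

primrec weighted_sum :: "nat list \<Rightarrow> nat" where
  "weighted_sum [] = 0"
| "weighted_sum (x # xs) = sum_list xs + weighted_sum xs"

lemma pair_products_append:
  "pair_products (xs @ ys) = pair_products xs + sum_list xs * sum_list ys + pair_products ys"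
  by (induction xs) (auto simp: algebra_simps)

lemma weighted_sum_append:
  "weighted_sum (xs @ ys) = weighted_sum xs + length xs * sum_list ys + weighted_sum ys"
  by (induction xs) (auto simp: algebra_simps)

definition word_order :: "(nat list \<times> nat list) set" where
  "word_order = measures [length, pair_products, weighted_sum]"

lemma wf_word_order: "wf word_order" unfolding word_order_def by simp

text \<open>The two alternatives for the new outer exponents are those that \<open>exchange\<close> allows when the
\<open>2 b + 1\<close> retained exponents are the smallest \<open>b\<close> and the largest \<open>b + 1\<close>. The product of the
outer exponents stays equal only for \<open>a = b = y\<close>, where \<open>(b, b, c)\<close> becomes \<open>(c, b, b)\<close>.\<close>
lemma valley_exchange_decreases:
  assumes abc: "b \<le> a" "b < c" and x: "x < b \<or> (y \<le> b)" and sum: "x + y = a + c"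
  shows "(pre @ x # b # y # post, pre @ a # b # c # post) \<in> word_order"
proof -
  have *: "x * y < a * c \<or> (x * y = a * c \<and> y < c)"
  proof (cases "x < b")
    case True
    define k where "k = a - x"
    have k: "a = x + k" "y = c + k" "0 < k" using True abc sum by (auto simp: k_def)
    have "k * x < k * c" using k True abc by simp
    then show ?thesis unfolding k by (simp add: algebra_simps)
  next
    case False
    then have "y \<le> b" using x by simp
    define k where "k = c - y"
    have k: "c = y + k" "x = a + k" "0 < k" using \<open>y \<le> b\<close> abc sum by (auto simp: k_def)
    have "k * y \<le> k * a" using \<open>y \<le> b\<close> abc by simp
    then show ?thesis using k unfolding k by (auto simp: algebra_simps)
  qed
  have pp: "pair_products (pre @ u # b # w # post)
      = pair_products pre + sum_list pre * ((u + w) + b + sum_list post)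
        + (u + w) * (b + sum_list post) + b * sum_list post + pair_products post + u * w" for u w
    by (simp add: pair_products_append algebra_simps)
  have ws: "weighted_sum (pre @ u # b # w # post)
      = weighted_sum pre + length pre * ((u + w) + b + sum_list post)
        + b + 3 * sum_list post + weighted_sum post + 2 * w" for u w
    by (simp add: weighted_sum_append algebra_simps)
  show ?thesis
    using * unfolding word_order_def in_measures pp ws sum by auto
qed

lemma last_descent:
  assumes "\<not> sorted_wrt (<) (xs :: nat list)"
  shows "\<exists>pre a b post. xs = pre @ a # b # post \<and> b \<le> a \<and> sorted_wrt (<) (b # post)"
  using assms
proof (induction xs)
  case (Cons x xs)
  show ?case
  proof (cases "sorted_wrt (<) xs")
    case False
    then obtain pre a b post where "xs = pre @ a # b # post" "b \<le> a" "sorted_wrt (<) (b # post)"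
      using Cons.IH by blast
    then show ?thesis by (intro exI[of _ "x # pre"]) auto
  next
    case True
    then obtain b post where xs: "xs = b # post" using Cons.prems by (cases xs) auto
    then have "b \<le> x" using Cons.prems True by fastforce
    then show ?thesis using True xs by (intro exI[of _ "[]"]) auto
  qed
qed simp

context raising_lowering
begin

definition increasing_words :: "'v \<Rightarrow> 'v set" where
  "increasing_words v = {alt_word js L R v |js. even (length js) \<and> sorted_wrt (<) js}"

lemma lin_alt_word: "lin X \<Longrightarrow> lin Y \<Longrightarrow> lin (alt_word js X Y)"
proof (induction js arbitrary: X Y)
  case Nil
  show ?case by (intro linI) simp_all
next
  case (Cons j js)
  show ?case
    using lin_compose[OF lin_funpow[OF Cons.prems(1)] Cons.IH[OF Cons.prems(2,1)]] by simp
qed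

text \<open>Consider the last descent of the exponents. If it is at the end of the word, then the tail
$L^a R^b$ with $a \ge b$ maps \<open>v\<close> to zero or to a multiple of \<open>v\<close>, and the word gets shorter.
Otherwise the descent is followed by an ascent, so the exponents have a valley
$a \ge b < c$ there, and \<open>exchange\<close> replaces it by smaller words. Exponents zero need no separate
treatment: a valley with \<open>b = 0\<close> merges two powers of the same operator.\<close>
lemma alt_word_in_span_increasing:
  assumes v: "v \<in> G 0" and eig: "\<And>n. \<exists>e. (L ^^ n) ((R ^^ n) v) = e *s v"
    and "even (length js)"
  shows "alt_word js L R v \<in> span (increasing_words v)"
  using assms(3)
proof (induction js rule: wf_induct_rule[OF wf_word_order])
  case (1 js)
  show ?case
  proof (cases "sorted_wrt (<) js")
    case True
    then show ?thesis using 1(2) unfolding increasing_words_def by (intro span_base) blast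
  next
    case False
    then obtain pre a b post where js: "js = pre @ a # b # post" and ba: "b \<le> a"
      and inc: "sorted_wrt (<) (b # post)" using last_descent by blast
    show ?thesis
    proof (cases post)
      case Nil
      have pre: "even (length pre)" using 1(2) js Nil by simp
      obtain e where e: "(L ^^ a) ((R ^^ b) v) = e *s v"
      proof (cases "b < a")
        case True
        then show ?thesis using L_R_vanish[OF v] that[of 0] by simp
      next
        case False
        then show ?thesis using ba eig[of a] that by auto
      qed
      have "alt_word js L R v = e *s alt_word pre L R v"
        unfolding js Nil using pre by (simp add: alt_word_append e lin_simps[OF lin_alt_word[OF lin_L lin_R]])
      moreover have "(pre, js) \<in> word_order" unfolding word_order_def js by simp
      ultimately show ?thesis using 1(1) pre by (simp add: span_scale)
    next
      case (Cons c post')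
      have bc: "b < c" using inc Cons by simp
      define X Y where "X = (if even (length pre) then L else R)" and "Y = (if even (length pre) then R else L)"
      have XY: "lin X" "lin Y" "higher_q_Serre q X Y" "higher_q_Serre q Y X"
        using lin_R lin_L higher_RL higher_LR by (auto simp: X_def Y_def)
      have word: "alt_word (pre @ x # b # y # post') L R v
          = alt_word pre L R ((X ^^ x) ((Y ^^ b) ((X ^^ y) (alt_word post' Y X v))))" for x y
        by (simp add: alt_word_append X_def Y_def)
      (* The hypothesis b \<le> a, b < c makes the two parts of ?S disjoint, hence of total size 2 b + 1. *)
      let ?n = "a + c"
      let ?S = "{..<b} \<union> {?n - b..?n}"
      have S: "?S \<subseteq> {..?n}" "card ?S = 2 * b + 1"
        using ba bc by (auto, subst card_Un_disjoint) auto
      obtain \<kappa> where \<kappa>: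
        "\<And>u. (X ^^ a) ((Y ^^ b) ((X ^^ (?n - a)) u)) = (\<Sum>x\<in>?S. \<kappa> x *s (X ^^ x) ((Y ^^ b) ((X ^^ (?n - x)) u)))"
        "\<And>u. (Y ^^ (?n - a)) ((X ^^ b) ((Y ^^ a) u)) = (\<Sum>x\<in>?S. \<kappa> x *s (Y ^^ (?n - x)) ((X ^^ b) ((Y ^^ x) u)))"
        using exchange[OF q_nonzero q_power XY(3,4) S le_add1] by blast
      have "alt_word js L R v = (\<Sum>x\<in>?S. \<kappa> x *s alt_word (pre @ x # b # (?n - x) # post') L R v)"
        unfolding js Cons word using \<kappa>(1)
        by (simp add: lin_simps[OF lin_alt_word[OF lin_L lin_R]])
      also have "\<dots> \<in> span (increasing_words v)"
      proof (intro span_sum span_scale)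
        fix x assume x: "x \<in> ?S"
        have "(pre @ x # b # (?n - x) # post', js) \<in> word_order"
          unfolding js Cons using x ba bc by (intro valley_exchange_decreases) auto
        then show "alt_word (pre @ x # b # (?n - x) # post') L R v \<in> span (increasing_words v)"
          by (rule 1(1)) (use 1(2) js Cons in simp)
      qed
      finally show ?thesis .
    qed
  qed
qed

end

section \<open>Weights of words and the spanning set of a graded piece\<close>

primrec weight :: "nat list \<Rightarrow> int" where
  "weight [] = 0"
| "weight (j # js) = - int j - weight js"

text \<open>The integer \<open>weight js\<close> is the degree of the word \<open>alt_word js L R v\<close> for \<open>v\<close> of degree 0. The
recursion changes sign because the roles of the two operators alternate.\<close>
lemma weight_eq_sum: "weight js = (\<Sum>h = 1..length js. int (js ! (h - 1)) * (- 1) ^ h)"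
proof (induction js)
  case (Cons j js)
  have "(\<Sum>h = 1..length (j # js). int ((j # js) ! (h - 1)) * (- 1) ^ h)
      = - int j + (\<Sum>h = Suc 1..Suc (length js). int ((j # js) ! (h - 1)) * (- 1) ^ h)"
    by (subst sum.atLeast_Suc_atMost) auto
  also have "(\<Sum>h = Suc 1..Suc (length js). int ((j # js) ! (h - 1)) * (- 1) ^ h)
      = (\<Sum>h = 1..length js. - (int (js ! (h - 1)) * (- 1) ^ h))"
    unfolding sum.shift_bounds_cl_Suc_ivl by (intro sum.cong) (auto simp: nth_Cons')
  finally show ?case using Cons.IH by (simp add: sum_negf)
qed simp

lemma admissible_iff:
  "admissible d i js \<longleftrightarrow>
     even (length js) \<and> sorted_wrt (<) js \<and> (\<forall>j\<in>set js. j \<le> d) \<and> weight js = int i"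
  unfolding admissible_def weight_eq_sum by auto

text \<open>Grouping the exponents as $(i_2 - i_1) + (i_4 - i_3) + \cdots$ gives a sum of positive integers.\<close>
lemma increasing_weight:
  assumes "even (length js)" "sorted_wrt (<) js"
  shows "0 \<le> weight js \<and> (weight js = 0 \<longrightarrow> js = [])"
  using assms
proof (induction js rule: induct_list012)
  case (3 a b js)
  then show ?case by auto
qed simp_all

lemma admissible_zero_iff: "admissible d 0 js \<longleftrightarrow> js = []"
  using increasing_weight[of js] by (auto simp: admissible_iff)

context raising_lowering
begin

lemma alt_word_G:
  assumes "v \<in> G 0"
  shows "alt_word js L R v \<in> G (weight js)" and "alt_word js R L v \<in> G (- weight js)"
proof (induction js)
  case (Cons j js)
  case 1
  have "- weight js - int j = weight (j # js)" by simp
  then show ?case using L_funpow_G[OF Cons(2), of j] by (simp only: alt_word.simps)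
  case 2
  then show ?case using R_funpow_G[OF Cons(1), of j] by (simp add: algebra_simps)
qed (use assms in simp_all)

lemma funpow_large:
  assumes "u \<in> G k" "d < j" shows "(L ^^ j) u = 0" and "(R ^^ j) u = 0"
proof -
  have "u = 0 \<or> (0 \<le> k \<and> k \<le> int d)"
    using assms G_negative[of k] G_large[of k] by force
  then show "(L ^^ j) u = 0" "(R ^^ j) u = 0"
    using L_funpow_G[OF assms(1), of j] R_funpow_G[OF assms(1), of j] assms(2)
      G_negative[of "k - int j"] G_large[of "k + int j"] by (auto simp: L_simps R_simps)
qed

text \<open>A power above \<open>d\<close> moves every degree out of the range \<open>0..d\<close>. This is why the exponents of a
spanning set can be bounded by \<open>d\<close>.\<close>
lemma alt_word_large:
  assumes v: "v \<in> G 0" and "j \<in> set js" "d < j"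
  shows "alt_word js L R v = 0" and "alt_word js R L v = 0"
  using assms(2)
proof (induction js)
  case (Cons k js)
  case 1
  then show ?case
    using Cons(2) funpow_large(1)[OF alt_word_G(2)[OF v]] assms(3) by (cases "j = k") (auto simp: L_simps)
  case 2
  then show ?case
    using Cons(1) funpow_large(2)[OF alt_word_G(1)[OF v]] assms(3) by (cases "j = k") (auto simp: R_simps)
qed simp_all

definition words :: "'v \<Rightarrow> 'v set" where
  "words v = {alt_word js L R v |js. even (length js)}"

lemma L_words:
  assumes v: "v \<in> G 0" and w: "w \<in> span (words v)" shows "L w \<in> span (words v)"
proof (rule lin_invariant_span[OF lin_L _ w])
  fix x assume "x \<in> words v"
  then obtain js where js: "even (length js)" "x = alt_word js L R v" by (auto simp: words_def)
  have "\<exists>ks. even (length ks) \<and> L x = alt_word ks L R v"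
  proof (cases js)
    case Nil
    then show ?thesis using js by (intro exI[of _ "[1, 0]"]) simp
  next
    case (Cons k ks)
    then show ?thesis using js by (intro exI[of _ "Suc k # ks"]) simp
  qed
  then show "L x \<in> span (words v)" by (auto simp: words_def intro!: span_base)
qed

lemma R_words:
  assumes w: "w \<in> span (words v)" shows "R w \<in> span (words v)"
proof (rule lin_invariant_span[OF lin_R _ w])
  fix x assume "x \<in> words v"
  then obtain js where js: "even (length js)" "x = alt_word js L R v" by (auto simp: words_def)
  then have "R x = alt_word (0 # 1 # js) L R v" by simp
  then show "R x \<in> span (words v)"
    using js(1) unfolding words_def by (intro span_base CollectI exI[of _ "0 # 1 # js"]) simp
qed

text \<open>The words are homogeneous, so the projection \<open>P\<close> of a spanning set of increasing words onto
degree \<open>i\<close> retains exactly the words of weight \<open>i\<close>, and those with an exponent above \<open>d\<close> vanish.\<close>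
lemma G_eq_span_admissible:
  assumes v: "v \<in> G 0" and eig: "\<And>n. \<exists>e. (L ^^ n) ((R ^^ n) v) = e *s v"
    and gen: "span (words v) = UNIV"
    and P: "lin P" "\<And>u. u \<in> G (int i) \<Longrightarrow> P u = u" "\<And>j u. j \<noteq> int i \<Longrightarrow> u \<in> G j \<Longrightarrow> P u = 0"
  shows "G (int i) = span {alt_word js L R v |js. admissible d i js}" (is "_ = span ?S")
proof
  show "span ?S \<subseteq> G (int i)"
  proof (rule span_minimal[OF _ subspace_G])
    have "alt_word js L R v \<in> G (int i)" if "admissible d i js" for js
      using that alt_word_G(1)[OF v, of js] by (simp add: admissible_iff)
    then show "?S \<subseteq> G (int i)" by blast
  qed
next
  have "words v \<subseteq> span (increasing_words v)"
    using alt_word_in_span_increasing[OF v eig] by (auto simp: words_def)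
  then have inc: "span (increasing_words v) = UNIV"
    using gen span_minimal[OF _ subspace_span] by (metis top.extremum_uniqueI)
  show "G (int i) \<subseteq> span ?S"
  proof
    fix u assume u: "u \<in> G (int i)"
    have "P u \<in> span ?S"
    proof (rule lin_span_into[OF P(1) subspace_span])
      show "u \<in> span (increasing_words v)" by (simp add: inc)
      fix x assume "x \<in> increasing_words v"
      then obtain js where js: "even (length js)" "sorted_wrt (<) js" and x: "x = alt_word js L R v"
        by (auto simp: increasing_words_def)
      show "P x \<in> span ?S"
      proof (cases "admissible d i js")
        case True
        then have "P x = x" using P(2) alt_word_G(1)[OF v, of js] x by (simp add: admissible_iff)
        then show ?thesis using True x by (auto intro: span_base)
      next
        case False
        then consider "weight js \<noteq> int i" | j where "j \<in> set js" "d < j"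
          using js by (auto simp: admissible_iff)
        then have "P x = 0"
        proof cases
          case 1
          then show ?thesis using P(3) alt_word_G(1)[OF v, of js] x by blast
        next
          case 2
          then show ?thesis using alt_word_large(1)[OF v] x by (simp add: lin_simps[OF P(1)])
        qed
        then show ?thesis by (simp add: span_zero)
      qed
    qed
    then show "u \<in> span ?S" using P(2)[OF u] by simp
  qed
qed

end

section \<open>Common eigenvectors of commuting operators\<close>

locale closed_endomorphisms = endomorphisms scale + finite_dimensional_vector_space scale Basis
  for scale :: "'k::alg_closed_field \<Rightarrow> 'v::ab_group_add \<Rightarrow> 'v" (infixr "*s" 75)
    and Basis :: "'v set"
begin

text \<open>For a nonzero \<open>u\<close> in \<open>W\<close>, take a polynomial \<open>p \<noteq> 0\<close> of least degree with \<open>p(T) u = 0\<close>. If \<open>z\<close>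
is a root and $p = (X - z) r$, then \<open>r(T) u\<close> is nonzero by minimality and is an eigenvector for \<open>z\<close>.\<close>
lemma eigenvector_in_invariant_subspace:
  assumes T: "lin T" and W: "subspace W" "W \<noteq> {0}" and T_W: "\<And>w. w \<in> W \<Longrightarrow> T w \<in> W"
  shows "\<exists>z w. w \<in> W \<and> w \<noteq> 0 \<and> T w = z *s w"
proof -
  obtain u where u: "u \<in> W" "u \<noteq> 0" using W subspace_0 by blast
  define ev where "ev = (\<lambda>p. \<Sum>i\<le>degree p. coeff p i *s (T ^^ i) u)"
  have ev: "ev p = (\<Sum>i\<le>N. coeff p i *s (T ^^ i) u)" if "degree p \<le> N" for p N
    unfolding ev_def using that by (intro sum.mono_neutral_left) (auto simp: coeff_eq_0)
  have "\<exists>p. p \<noteq> 0 \<and> ev p = 0"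
  proof (rule ccontr)
    assume "\<not> ?thesis"
    then have none: "p = 0" if "ev p = 0" for p using that by blast
    (* Without such a polynomial, the powers of T applied to u would be linearly independent. *)
    have comb: "\<forall>i\<le>N. f i = 0" if "(\<Sum>i\<le>N. f i *s (T ^^ i) u) = 0" for f N
    proof -
      define p where "p = (\<Sum>i\<le>N. monom (f i) i)"
      have c: "coeff p i = (if i \<le> N then f i else 0)" for i
        by (simp add: p_def coeff_sum)
      have "degree p \<le> N" by (rule degree_le) (simp add: c)
      then have "ev p = (\<Sum>i\<le>N. f i *s (T ^^ i) u)"
        by (subst ev) (auto simp: c intro: sum.cong)
      then have "ev p = 0" using that by simp
      then have "p = 0" by (rule none)
      then show ?thesis using c by (metis coeff_0)
    qed
    have inj: "inj (\<lambda>i. (T ^^ i) u)"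
    proof (rule linorder_injI, rule notI)
      fix x y :: nat assume xy: "x < y" and eq: "(T ^^ x) u = (T ^^ y) u"
      define f :: "nat \<Rightarrow> 'k" where "f = (\<lambda>i. (if i = x then 1 else 0) - (if i = y then 1 else 0))"
      have "(\<Sum>i\<le>y. f i *s (T ^^ i) u)
          = (\<Sum>i\<le>y. if i = x then (T ^^ i) u else 0) - (\<Sum>i\<le>y. if i = y then (T ^^ i) u else 0)"
        unfolding f_def sum_subtractf[symmetric] by (intro sum.cong) (auto simp: scale_left_diff_distrib)
      also have "\<dots> = 0" using xy eq by simp
      finally have "f y = 0" using comb by blast
      then show False using xy by (simp add: f_def)
    qed
    define B where "B = (\<lambda>i. (T ^^ i) u) ` {..dim UNIV}"
    have "independent B"
    proof (rule independent_if_scalars_zero)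
      show "finite B" by (simp add: B_def)
      fix g x assume "(\<Sum>x\<in>B. g x *s x) = 0" and x: "x \<in> B"
      moreover have "(\<Sum>x\<in>B. g x *s x) = (\<Sum>i\<le>dim UNIV. g ((T ^^ i) u) *s (T ^^ i) u)"
        unfolding B_def by (subst sum.reindex) (auto intro: inj_on_subset[OF inj])
      ultimately show "g x = 0" using comb[of "\<lambda>i. g ((T ^^ i) u)"] by (auto simp: B_def)
    qed
    then have "card B \<le> dim UNIV" by (rule independent_card_le_dim[OF subset_UNIV])
    moreover have "card B = Suc (dim UNIV)"
      unfolding B_def by (subst card_image) (auto intro: inj_on_subset[OF inj])
    ultimately show False by simp
  qed
  then obtain p where p: "p \<noteq> 0" "ev p = 0"
    and least: "\<And>r. r \<noteq> 0 \<and> ev r = 0 \<Longrightarrow> degree p \<le> degree r"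
    using ex_has_least_nat[of "\<lambda>p. p \<noteq> 0 \<and> ev p = 0" _ degree] by blast
  have "degree p \<noteq> 0"
  proof
    assume "degree p = 0"
    then obtain c where c: "p = [:c:]" using degree_eq_zeroE by blast
    then have "c *s u = 0" using p(2) by (simp add: ev_def)
    then show False using p(1) c u(2) by simp
  qed
  then obtain z where "poly p z = 0" using alg_closed_imp_poly_has_root[of p] by auto
  then obtain r where r: "p = [:- z, 1:] * r" using poly_eq_0_iff_dvd by (metis dvdE)
  have r0: "r \<noteq> 0" using p(1) r by auto
  have deg: "degree p = Suc (degree r)" unfolding r using r0 by (subst degree_mult_eq) auto
  have w0: "ev r \<noteq> 0" using least[of r] r0 deg by auto
  have coeff_p: "coeff p i = coeff (pCons 0 r) i - z * coeff r i" for i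
    unfolding r by simp
  have "ev p = (\<Sum>i\<le>Suc (degree r). coeff (pCons 0 r) i *s (T ^^ i) u)
      - (\<Sum>i\<le>Suc (degree r). z *s coeff r i *s (T ^^ i) u)"
    unfolding ev[OF eq_imp_le[OF deg]] coeff_p by (simp add: scale_left_diff_distrib sum_subtractf)
  also have "(\<Sum>i\<le>Suc (degree r). z *s coeff r i *s (T ^^ i) u) = z *s ev r"
    unfolding scale_sum_right[symmetric] by (subst ev[of r "Suc (degree r)"]) auto
  also have "(\<Sum>i\<le>Suc (degree r). coeff (pCons 0 r) i *s (T ^^ i) u) = T (ev r)"
    unfolding sum.atMost_Suc_shift by (simp add: ev_def lin_simps[OF T])
  finally have "T (ev r) = z *s ev r" using p(2) by simp
  moreover have "(T ^^ i) u \<in> W" for i by (induction i) (auto simp: u T_W)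
  then have "ev r \<in> W" unfolding ev_def by (intro subspace_sum subspace_scale W(1))
  ultimately show ?thesis using w0 by blast
qed

text \<open>On an invariant subspace of least positive dimension every \<open>T n\<close> is a scalar, since the eigenspace
of \<open>T n\<close> in it is again invariant under the whole family.\<close>
lemma common_eigenvector:
  assumes T: "\<And>n::nat. lin (T n)" and W: "subspace W" "W \<noteq> {0}"
    and T_W: "\<And>n w. w \<in> W \<Longrightarrow> T n w \<in> W"
    and comm: "\<And>m n w. w \<in> W \<Longrightarrow> T m (T n w) = T n (T m w)"
  shows "\<exists>w\<in>W. w \<noteq> 0 \<and> (\<forall>n. \<exists>e. T n w = e *s w)"
proof -
  define P where "P = (\<lambda>S. subspace S \<and> S \<subseteq> W \<and> S \<noteq> {0} \<and> (\<forall>n. \<forall>w\<in>S. T n w \<in> S))"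
  have "P W" using W T_W by (simp add: P_def)
  then obtain S where S: "P S" and least: "\<And>K. P K \<Longrightarrow> dim S \<le> dim K"
    using ex_has_least_nat[of P W dim] by blast
  have S': "subspace S" "S \<subseteq> W" "S \<noteq> {0}" "\<And>n w. w \<in> S \<Longrightarrow> T n w \<in> S"
    using S by (auto simp: P_def)
  have "\<exists>e. \<forall>w\<in>S. T n w = e *s w" for n
  proof -
    obtain z w where w: "w \<in> S" "w \<noteq> 0" "T n w = z *s w"
      using eigenvector_in_invariant_subspace[OF T S'(1,3,4)] by blast
    define K where "K = {x \<in> S. T n x = z *s x}"
    have sub: "subspace K"
      using S'(1) unfolding subspace_def K_def by (auto simp: lin_simps[OF T] scale_right_distrib mult.commute)
    have "T m x \<in> K" if "x \<in> K" for m x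
      using that S'(2,4) comm[of x n m] by (auto simp: K_def lin_simps[OF T])
    then have "P K" using sub w S'(2) by (auto simp: P_def K_def)
    then have "K = S" using least sub S'(1) by (intro subspace_dim_equal) (auto simp: K_def)
    then show ?thesis by (auto simp: K_def)
  qed
  moreover obtain w where "w \<in> S" "w \<noteq> 0" using S'(1,3) subspace_0 by blast
  ultimately show ?thesis using S'(2) by blast
qed

end

section \<open>The split decomposition\<close>

context endomorphisms
begin

text \<open>The component maps of the direct sum are linear and satisfy the conditions that describe the
projections, which also determine a linear map uniquely because the \<open>U j\<close> span. This justifies the
definite description in the definition of \<open>projection\<close>.\<close>
lemma projection_properties:
  assumes U: "direct_decomposition scale d U" and i: "i \<le> d"
  shows "lin (projection scale d U i)"
    and "u \<in> U i \<Longrightarrow> projection scale d U i u = u"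
    and "j \<le> d \<Longrightarrow> j \<noteq> i \<Longrightarrow> u \<in> U j \<Longrightarrow> projection scale d U i u = 0"
    and "projection scale d U i u \<in> U i"
    and "(\<Sum>h\<le>d. projection scale d U h u) = u"
proof -
  have sub: "subspace (U j)" if "j \<le> d" for j
    using U that by (simp add: direct_decomposition_def)
  define C where "C = (\<lambda>v. THE u. u \<in> PiE {..d} U \<and> v = (\<Sum>i\<le>d. u i))"
  have ex: "\<exists>!u. u \<in> PiE {..d} U \<and> v = (\<Sum>i\<le>d. u i)" for v
    using U by (simp add: direct_decomposition_def)
  have C: "C v \<in> PiE {..d} U" "v = (\<Sum>i\<le>d. C v i)" for v
    using theI'[OF ex[of v]] by (simp_all add: C_def)
  have C_eq: "C v j = f j" if "\<And>j. j \<le> d \<Longrightarrow> f j \<in> U j" "v = (\<Sum>i\<le>d. f i)" "j \<le> d" for v f j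
  proof -
    have "restrict f {..d} \<in> PiE {..d} U \<and> v = (\<Sum>i\<le>d. restrict f {..d} i)" using that by auto
    then have "C v = restrict f {..d}" using ex[of v] C[of v] by blast
    then show ?thesis using that(3) by simp
  qed
  have C_in: "C v j \<in> U j" if "j \<le> d" for v j using C(1)[of v] that by auto
  have C_lin: "lin (\<lambda>v. C v j)" if j: "j \<le> d" for j
  proof (rule linI)
    show "C (x + y) j = C x j + C y j" for x y
    proof (rule C_eq[where f = "\<lambda>i. C x i + C y i", OF _ _ j])
      show "x + y = (\<Sum>i\<le>d. C x i + C y i)" unfolding sum.distrib C(2)[symmetric] ..
    qed (use sub subspace_add C_in in blast)
    show "C (c *s x) j = c *s C x j" for c x
    proof (rule C_eq[where f = "\<lambda>i. c *s C x i", OF _ _ j])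
      show "c *s x = (\<Sum>i\<le>d. c *s C x i)" unfolding scale_sum_right[symmetric] C(2)[symmetric] ..
    qed (use sub subspace_scale C_in in blast)
  qed
  have C_U: "C u h = (if h = j then u else 0)" if "u \<in> U j" "j \<le> d" "h \<le> d" for u j h
  proof (rule C_eq[where f = "\<lambda>h. if h = j then u else 0"])
    show "(if h = j then u else 0) \<in> U h" if "h \<le> d" for h
      using \<open>u \<in> U j\<close> that subspace_0[OF sub] by auto
  qed (use that in simp_all)
  have proj: "projection scale d U h = (\<lambda>v. C v h)" if h: "h \<le> d" for h
    unfolding projection_def
  proof (rule the_equality)
    show "lin (\<lambda>v. C v h) \<and> (\<forall>u\<in>U h. C u h - u = 0) \<and> (\<forall>j\<le>d. j \<noteq> h \<longrightarrow> (\<forall>u\<in>U j. C u h = 0))"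
      using C_lin h C_U by auto
    fix F assume F: "lin F \<and> (\<forall>u\<in>U h. F u - u = 0) \<and> (\<forall>j\<le>d. j \<noteq> h \<longrightarrow> (\<forall>u\<in>U j. F u = 0))"
    show "F = (\<lambda>v. C v h)"
    proof
      fix v
      have "F v = (\<Sum>j\<le>d. F (C v j))" using F C(2)[of v] pair.linear_sum by metis
      also have "\<dots> = (\<Sum>j\<le>d. if j = h then C v j else 0)"
        using F C_in by (intro sum.cong) auto
      finally show "F v = C v h" using h by simp
    qed
  qed
  show "lin (projection scale d U i)" using C_lin proj i by simp
  show "u \<in> U i \<Longrightarrow> projection scale d U i u = u" using C_U proj i by simp
  show "j \<le> d \<Longrightarrow> j \<noteq> i \<Longrightarrow> u \<in> U j \<Longrightarrow> projection scale d U i u = 0" using C_U proj i by simp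
  show "projection scale d U i u \<in> U i" using C_in proj i by simp
  show "(\<Sum>h\<le>d. projection scale d U h u) = u" using C(2)[of u] proj by simp
qed

end

locale split_operators = endomorphisms scale
  for scale :: "'k::field \<Rightarrow> 'v::ab_group_add \<Rightarrow> 'v" (infixr "*s" 75) +
  fixes A As :: "'v \<Rightarrow> 'v" and d :: nat and \<theta> \<theta>s :: "nat \<Rightarrow> 'k" and U :: "nat \<Rightarrow> 'v set"
  assumes lin_A: "lin A" and lin_As: "lin As"
    and split: "split_decomposition scale A As d \<theta> \<theta>s U"
begin

abbreviation F :: "nat \<Rightarrow> 'v \<Rightarrow> 'v" where "F \<equiv> projection scale d U"

abbreviation R :: "'v \<Rightarrow> 'v" where "R \<equiv> raising scale A d \<theta> U"

abbreviation L :: "'v \<Rightarrow> 'v" where "L \<equiv> lowering scale As d \<theta>s U"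

abbreviation G :: "int \<Rightarrow> 'v set" where "G \<equiv> zero_ext d U"

text \<open>The diagonal parts of \<open>A\<close> and \<open>As\<close> with respect to the split decomposition.\<close>
definition D :: "'v \<Rightarrow> 'v" where "D u = (\<Sum>h\<le>d. \<theta> h *s F h u)"

definition Ds :: "'v \<Rightarrow> 'v" where "Ds u = (\<Sum>h\<le>d. \<theta>s h *s F h u)"

lemma R_eq: "R = (\<lambda>u. A u - D u)" and L_eq: "L = (\<lambda>u. As u - Ds u)"
  by (auto simp: raising_def lowering_def D_def Ds_def)

lemma direct: "direct_decomposition scale d U"
  using split by (simp add: split_decomposition_def)

lemmas F_properties = projection_properties[OF direct]

lemma subspace_U: "j \<le> d \<Longrightarrow> subspace (U j)"
  using direct by (simp add: direct_decomposition_def)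

lemma F_U: "u \<in> U j \<Longrightarrow> j \<le> d \<Longrightarrow> h \<le> d \<Longrightarrow> F h u = (if h = j then u else 0)"
  using F_properties(2,3)[of h] by auto

lemma span_U: "span (\<Union>j\<in>{..d}. U j) = UNIV"
proof -
  have "u \<in> span (\<Union>j\<in>{..d}. U j)" for u
    by (subst F_properties(5)[of 0 u, symmetric, OF le0])
       (intro span_sum span_base, use F_properties(4) in blast)
  then show ?thesis by blast
qed

lemma lin_D: "lin D" "lin Ds"
  unfolding D_def[abs_def] Ds_def[abs_def] using F_properties(1) by (auto intro!: lin_lin_comb)

lemma lin_RL: "lin R" "lin L"
  unfolding R_eq L_eq using lin_A lin_As lin_D by (simp_all add: lin_diff)

lemma D_U:
  assumes "u \<in> U j" "j \<le> d" shows "D u = \<theta> j *s u" "Ds u = \<theta>s j *s u"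
proof -
  have "(\<Sum>h\<le>d. f h *s F h u) = (\<Sum>h\<le>d. if h = j then f h *s u else 0)" for f
    using F_U[OF assms] by (intro sum.cong) auto
  then show "D u = \<theta> j *s u" "Ds u = \<theta>s j *s u"
    using assms(2) by (simp_all add: D_def Ds_def)
qed

lemma R_U: "u \<in> U j \<Longrightarrow> j < d \<Longrightarrow> R u \<in> U (j + 1)"
  using split D_U(1)[of u j] by (auto simp: R_eq split_decomposition_def)

lemma R_top: "u \<in> U d \<Longrightarrow> R u = 0"
  using split D_U(1)[of u d] by (auto simp: R_eq split_decomposition_def)

lemma L_U: "u \<in> U j \<Longrightarrow> 0 < j \<Longrightarrow> j \<le> d \<Longrightarrow> L u \<in> U (j - 1)"
  using split D_U(2)[of u j] by (auto simp: L_eq split_decomposition_def)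

lemma L_bottom: "u \<in> U 0 \<Longrightarrow> L u = 0"
  using split D_U(2)[of u 0] by (auto simp: L_eq split_decomposition_def)

lemma G_U: "j \<le> d \<Longrightarrow> G (int j) = U j"
  by (simp add: zero_ext_def)

lemma G_cases:
  assumes "u \<in> G j"
  obtains "u = 0" | h where "h \<le> d" "j = int h" "u \<in> U h"
proof (cases "0 \<le> j \<and> j \<le> int d")
  case True
  then show ?thesis using that(2)[of "nat j"] assms by (auto simp: zero_ext_def)
next
  case False
  then show ?thesis using that(1) assms by (auto simp: zero_ext_def split: if_splits)
qed

lemma subspace_G: "subspace (G j)"
  using subspace_U[of "nat j"] by (auto simp: zero_ext_def)

lemma R_G: "u \<in> G j \<Longrightarrow> R u \<in> G (j + 1)"
proof (erule G_cases)
  assume "u = 0"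
  then show ?thesis using subspace_0[OF subspace_G] by (simp add: lin_simps[OF lin_RL(1)])
next
  fix h assume h: "h \<le> d" "j = int h" "u \<in> U h"
  show ?thesis
  proof (cases "h = d")
    case True
    then show ?thesis using R_top h(3) subspace_0[OF subspace_G] by simp
  next
    case False
    then show ?thesis using R_U[OF h(3)] G_U[of "h + 1"] h by (simp add: ac_simps)
  qed
qed

lemma L_G: "u \<in> G j \<Longrightarrow> L u \<in> G (j - 1)"
proof (erule G_cases)
  assume "u = 0"
  then show ?thesis using subspace_0[OF subspace_G] by (simp add: lin_simps[OF lin_RL(2)])
next
  fix h assume h: "h \<le> d" "j = int h" "u \<in> U h"
  show ?thesis
  proof (cases "h = 0")
    case True
    then show ?thesis using L_bottom h(3) subspace_0[OF subspace_G] by simp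
  next
    case False
    then show ?thesis using L_U[OF h(3)] G_U[of "h - 1"] h by (simp add: of_nat_diff)
  qed
qed

lemma D_G: assumes u: "u \<in> G j" shows "D u \<in> G j" "Ds u \<in> G j"
proof -
  have "D u \<in> G j \<and> Ds u \<in> G j"
    using u
  proof (cases rule: G_cases)
    case 1
    then show ?thesis
      using subspace_0[OF subspace_G] by (simp add: lin_simps[OF lin_D(1)] lin_simps[OF lin_D(2)])
  next
    case (2 h)
    then show ?thesis using D_U[OF 2(3,1)] u subspace_scale[OF subspace_G] by simp
  qed
  then show "D u \<in> G j" "Ds u \<in> G j" by blast+
qed

lemma span_G: "span (\<Union>j. G j) = UNIV"
proof -
  have "(\<Union>j\<in>{..d}. U j) \<subseteq> (\<Union>j. G j)" using G_U by fastforce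
  then show ?thesis using span_U span_mono by blast
qed

lemma F_G: "u \<in> G j \<Longrightarrow> h \<le> d \<Longrightarrow> F h u = (if j = int h then u else 0)"
  using F_U[of u _ h] by (erule_tac G_cases) (auto simp: lin_simps[OF F_properties(1)])

lemma G_independent:
  assumes u: "u \<in> G j" "u \<in> span (\<Union>h\<in>H. G h)" "j \<notin> H" shows "u = 0"
  using u(1)
proof (cases rule: G_cases)
  case (2 h)
  have "F h u = 0"
  proof (rule lin_zero_on_span[OF F_properties(1)[OF 2(1)] _ u(2)])
    fix x assume "x \<in> (\<Union>h\<in>H. G h)"
    then show "F h x = 0" using F_G[OF _ 2(1)] u(3) 2(2) by auto
  qed
  then show ?thesis using F_U[OF 2(3,1,1)] by simp
qed

text \<open>The words are homogeneous, so their span is invariant under the projections, and therefore under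
the diagonal parts of \<open>A\<close> and \<open>As\<close> as well as under \<open>R\<close> and \<open>L\<close>.\<close>
lemma words_span_invariant_subspace:
  assumes "raising_lowering scale q R L G d" and w: "w \<in> U 0"
  shows "A ` span (raising_lowering.words R L w) \<subseteq> span (raising_lowering.words R L w)"
    and "As ` span (raising_lowering.words R L w) \<subseteq> span (raising_lowering.words R L w)"
proof -
  interpret raising_lowering scale q R L G d by fact
  have w0: "w \<in> G 0" using w G_U[of 0] by simp
  have "F h x \<in> span (words w)" if h: "h \<le> d" and x: "x \<in> span (words w)" for h x
  proof (rule lin_invariant_span[OF F_properties(1)[OF h] _ x])
    fix y assume y: "y \<in> words w"
    then obtain js where "y = alt_word js L R w" by (auto simp: words_def)
    then have yG: "y \<in> G (weight js)" using alt_word_G(1)[OF w0] by simp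
    show "F h y \<in> span (words w)" unfolding F_G[OF yG h] using y span_zero span_base by auto
  qed
  then have D_words: "D x \<in> span (words w)" "Ds x \<in> span (words w)" if "x \<in> span (words w)" for x
    unfolding D_def Ds_def using that by (auto intro!: span_sum span_scale)
  have "R x + D x \<in> span (words w)" "L x + Ds x \<in> span (words w)" if "x \<in> span (words w)" for x
    using R_words[OF that] L_words[OF w0 that] D_words[OF that] span_add by auto
  then show "A ` span (words w) \<subseteq> span (words w)" "As ` span (words w) \<subseteq> span (words w)"
    by (auto simp: R_eq L_eq)
qed

end

locale q_split_operators = split_operators scale A As d \<theta> \<theta>s U
  for scale :: "'k::field \<Rightarrow> 'v::ab_group_add \<Rightarrow> 'v" (infixr "*s" 75)
    and A As :: "'v \<Rightarrow> 'v" and d :: nat and \<theta> \<theta>s :: "nat \<Rightarrow> 'k" and U :: "nat \<Rightarrow> 'v set" +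
  fixes q a as :: 'k
  assumes q_nonzero: "q \<noteq> 0" and q_power: "0 < n \<Longrightarrow> q ^ n \<noteq> 1"
    and Serre: "q_Serre scale q A As" and Serre_dual: "q_Serre scale q As A"
    and diag: "diagonalizable scale A" "diagonalizable scale As"
    and eigenvalues_A: "bij_betw \<theta> {..d} (eigenvalues scale A)"
    and eigenvalues_As: "bij_betw \<theta>s {..d} (eigenvalues scale As)"
    and \<theta>: "j \<le> d \<Longrightarrow> \<theta> j = a * q powi (2 * int j - int d)"
    and \<theta>s: "j \<le> d \<Longrightarrow> \<theta>s j = as * q powi (int d - 2 * int j)"
begin

lemma \<theta>_Suc: "j < d \<Longrightarrow> \<theta> (j + 1) = q ^ 2 * \<theta> j"
proof -
  assume j: "j < d"
  have "2 * int (j + 1) - int d = 2 + (2 * int j - int d)" by simp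
  then have "q powi (2 * int (j + 1) - int d) = q powi 2 * q powi (2 * int j - int d)"
    using q_nonzero by (metis power_int_add)
  then show ?thesis using j by (simp add: \<theta>)
qed

lemma \<theta>s_Suc: "j < d \<Longrightarrow> \<theta>s j = q ^ 2 * \<theta>s (j + 1)"
proof -
  assume j: "j < d"
  have "int d - 2 * int j = 2 + (int d - 2 * int (j + 1))" by simp
  then have "q powi (int d - 2 * int j) = q powi 2 * q powi (int d - 2 * int (j + 1))"
    using q_nonzero by (metis power_int_add)
  then show ?thesis using j by (simp add: \<theta>s)
qed

lemma \<theta>_times_\<theta>s: "j \<le> d \<Longrightarrow> \<theta> j * \<theta>s j = a * as"
  using q_nonzero by (simp add: \<theta> \<theta>s flip: power_int_add)

text \<open>The operators \<open>A\<close> and \<open>Ds\<close> satisfy a $q$-Weyl relation, because \<open>R\<close> multiplies the eigenvalue of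
\<open>Ds\<close> by $q^{-2}$ and $\theta_j \theta^*_j$ does not depend on \<open>j\<close>. Hence they satisfy the $q$-Serre
relation, and so does $L = A^* - D^*$ in place of $A^*$ because the relation is linear in its second
operator. Passing to \<open>L\<close> but retaining \<open>A\<close> keeps one diagonalizable operator in the pair.\<close>
lemma q_Serre_A_L: "q_Serre scale q A L"
proof -
  have weyl: "A (Ds u) = q ^ 2 *s Ds (A u) + ((1 - q ^ 2) * (a * as)) *s u" for u
  proof (rule q_Weyl_relation[OF lin_A lin_D(2) span_U])
    fix x assume "x \<in> (\<Union>j\<in>{..d}. U j)"
    then obtain j where j: "x \<in> U j" "j \<le> d" by blast
    have R: "A x - \<theta> j *s x = R x" by (simp add: R_eq D_U(1)[OF j])
    have "q ^ 2 *s Ds (R x) = \<theta>s j *s R x"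
    proof (cases "j = d")
      case True
      then show ?thesis using R_top j by (simp add: lin_simps[OF lin_D(2)])
    next
      case False
      then show ?thesis using D_U(2)[OF R_U[OF j(1)]] j(2) \<theta>s_Suc[of j] by simp
    qed
    then show "\<exists>s t. Ds x = t *s x \<and> q ^ 2 *s Ds (A x - s *s x) = t *s (A x - s *s x) \<and> s * t = a * as"
      using D_U(2)[OF j] \<theta>_times_\<theta>s[OF j(2)] R by metis
  qed
  have "q ^ 2 \<noteq> 1" using q_power[of 2] by simp
  then show ?thesis
    unfolding L_eq using q_Serre_diff[OF lin_A Serre q_Serre_q_Weyl[OF lin_A q_nonzero _ weyl]] by simp
qed

lemma q_Serre_As_R: "q_Serre scale q As R"
proof -
  have weyl: "As (D u) = q ^ 2 *s D (As u) + ((1 - q ^ 2) * (a * as)) *s u" for u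
  proof (rule q_Weyl_relation[OF lin_As lin_D(1) span_U])
    fix x assume "x \<in> (\<Union>j\<in>{..d}. U j)"
    then obtain j where j: "x \<in> U j" "j \<le> d" by blast
    have L: "As x - \<theta>s j *s x = L x" by (simp add: L_eq D_U(2)[OF j])
    have "q ^ 2 *s D (L x) = \<theta> j *s L x"
    proof (cases "j = 0")
      case True
      then show ?thesis using L_bottom j by (simp add: lin_simps[OF lin_D(1)])
    next
      case False
      then show ?thesis using D_U(1)[OF L_U[OF j(1)]] j(2) \<theta>_Suc[of "j - 1"] by simp
    qed
    moreover have "\<theta>s j * \<theta> j = a * as" using \<theta>_times_\<theta>s[OF j(2)] by (simp add: mult.commute)
    ultimately show "\<exists>s t. D x = t *s x \<and> q ^ 2 *s D (As x - s *s x) = t *s (As x - s *s x) \<and> s * t = a * as"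
      using D_U(1)[OF j] L by metis
  qed
  have "q ^ 2 \<noteq> 1" using q_power[of 2] by simp
  then show ?thesis
    unfolding R_eq using q_Serre_diff[OF lin_As Serre_dual q_Serre_q_Weyl[OF lin_As q_nonzero _ weyl]] by simp
qed

text \<open>First the pair \<open>(A, L)\<close>, where diagonalizability applies, and then its leading part \<open>(R, L)\<close>; for
\<open>(L, R)\<close> the pair \<open>(As, R)\<close> is used with the reversed grading. If \<open>d > 0\<close>, then \<open>a\<close> and \<open>as\<close> are
nonzero because the eigenvalues are distinct; if \<open>d = 0\<close>, then \<open>a\<close> may be zero but \<open>R\<close> and
\<open>L\<close> vanish.\<close>
lemma higher_q_Serre_R_L: "higher_q_Serre q R L" and higher_q_Serre_L_R: "higher_q_Serre q L R"
proof -
  have "higher_q_Serre q R L \<and> higher_q_Serre q L R"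
  proof (cases "d = 0")
    case True
    have "x \<in> U 0" for x
      using F_properties(4)[of 0 x] F_properties(5)[of 0 x] True by simp
    then have "R = (\<lambda>_. 0)" "L = (\<lambda>_. 0)" using R_top L_bottom True by auto
    then show ?thesis using higher_q_Serre_zero by simp
  next
    case False
    have ev: "eigenvalues scale A = \<theta> ` {..d}" "inj_on \<theta> {..d}"
      "eigenvalues scale As = \<theta>s ` {..d}" "inj_on \<theta>s {..d}"
      using eigenvalues_A eigenvalues_As by (auto simp: bij_betw_def)
    have "a \<noteq> 0" using inj_onD[OF ev(2), of 0 d] False \<theta>[of 0] \<theta>[of d] by auto
    then have nonzero: "0 \<notin> eigenvalues scale A" using \<theta> q_nonzero by (auto simp: ev(1))
    have "as \<noteq> 0" using inj_onD[OF ev(4), of 0 d] False \<theta>s[of 0] \<theta>s[of d] by auto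
    then have nonzero': "0 \<notin> eigenvalues scale As" using \<theta>s q_nonzero by (auto simp: ev(3))
    have q: "q ^ 2 \<noteq> 1" "q ^ 4 \<noteq> 1" using q_power[of 2] q_power[of 4] by auto
    have AL: "higher_q_Serre q A L"
      by (rule higher_q_Serre_if_diagonalizable[OF lin_A lin_RL(2) q_nonzero q q_Serre_A_L diag(1) nonzero])
    have AsR: "higher_q_Serre q As R"
      by (rule higher_q_Serre_if_diagonalizable[OF lin_As lin_RL(1) q_nonzero q q_Serre_As_R diag(2) nonzero'])
    have "higher_q_Serre q R L"
    proof (rule higher_q_Serre_leading_part[OF lin_A lin_RL subspace_G R_G L_G _ span_G _ AL])
      show "A u - R u \<in> G j" if "u \<in> G j" for j u using D_G(1)[OF that] by (simp add: R_eq)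
      show "u = 0" if "u \<in> G j" "u \<in> span (\<Union>h\<in>{..<j}. G h)" for j u
        using G_independent[OF that] by simp
    qed
    moreover have "higher_q_Serre q L R"
    proof (rule higher_q_Serre_leading_part[where G = "\<lambda>j. G (- j)", OF lin_As lin_RL(2,1) subspace_G _ _ _ _ _ AsR])
      show "L u \<in> G (- (j + 1))" if "u \<in> G (- j)" for j u using L_G[OF that] by simp
      show "R u \<in> G (- (j - 1))" if "u \<in> G (- j)" for j u using R_G[OF that] by simp
      show "As u - L u \<in> G (- j)" if "u \<in> G (- j)" for j u using D_G(2)[OF that] by (simp add: L_eq)
      have "(\<Union>j. G j) \<subseteq> (\<Union>j. G (- j))"
      proof
        fix x assume "x \<in> (\<Union>j. G j)"
        then obtain j where "x \<in> G (- (- j))" by auto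
        then show "x \<in> (\<Union>j. G (- j))" by blast
      qed
      then show "span (\<Union>j. G (- j)) = UNIV" using span_G span_mono by blast
      show "u = 0" if "u \<in> G (- j)" "u \<in> span (\<Union>h\<in>{..<j}. G (- h))" for j u
      proof (rule G_independent[OF that(1)])
        show "u \<in> span (\<Union>h\<in>uminus ` {..<j}. G h)" using that(2) by (simp only: image_image)
      qed auto
    qed
    ultimately show ?thesis by blast
  qed
  then show "higher_q_Serre q R L" "higher_q_Serre q L R" by blast+
qed

lemma raising_lowering: "raising_lowering scale q R L G d"
proof (intro raising_lowering.intro endomorphisms_axioms raising_lowering_axioms.intro)
  show "G j = {0}" if "j < 0" for j using that by (simp add: zero_ext_def)
  show "G j = {0}" if "int d < j" for j using that by (simp add: zero_ext_def)
qed (fact q_nonzero q_power lin_RL subspace_G R_G L_G higher_q_Serre_R_L higher_q_Serre_L_R)+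

end

section \<open>The spanning set for the split decomposition\<close>

theorem theorem1p9:
  fixes scale :: "'k::{alg_closed_field, field_char_0} \<Rightarrow> 'v::ab_group_add \<Rightarrow> 'v"
    and Basis :: "'v set"
    and q a as :: 'k
    and A As R L :: "'v \<Rightarrow> 'v"
    and \<theta> \<theta>s :: "nat \<Rightarrow> 'k"
    and U :: "nat \<Rightarrow> 'v set"
    and v :: 'v
    and d i :: nat
  assumes V: "finite_dimensional_vector_space scale Basis"
    and dim_pos: "0 < vector_space.dim scale (UNIV :: 'v set)"
    and q_nonzero: "q \<noteq> 0"
    and q_not_root_of_unity: "\<not> (\<exists>n::nat. 0 < n \<and> q ^ n = 1)"
    and TD: "tridiagonal_pair scale A As"
    and diam: "has_diameter scale A As d"
    and Serre: "q_Serre scale q A As"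
    and Serre_dual: "q_Serre scale q As A"
    and \<theta>_def: "\<And>j. j \<le> d \<Longrightarrow> \<theta> j = a * q powi (2 * int j - int d)"
    and \<theta>s_def: "\<And>j. j \<le> d \<Longrightarrow> \<theta>s j = as * q powi (int d - 2 * int j)"
    and \<theta>_standard: "standard_eigenvalues scale A As d \<theta>"
    and \<theta>s_standard: "standard_eigenvalues scale As A d \<theta>s"
    and split: "split_decomposition scale A As d \<theta> \<theta>s U"
    and R_def: "R = raising scale A d \<theta> U"
    and L_def: "L = lowering scale As d \<theta>s U"
    and v_in: "v \<in> U 0"
    and v_nonzero: "v \<noteq> 0"
    and i_le: "i \<le> d"
  shows "U i = module.span scale {alt_word js L R v | js. admissible d i js}"
proof -
  interpret finite_dimensional_vector_space scale Basis by (rule V)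
  interpret closed_endomorphisms scale Basis ..
  have TD': "lin A" "lin As" "diagonalizable scale A" "diagonalizable scale As"
    and irreducible: "\<And>W. subspace W \<Longrightarrow> A ` W \<subseteq> W \<Longrightarrow> As ` W \<subseteq> W \<Longrightarrow> W \<noteq> {0} \<Longrightarrow> W = UNIV"
    using TD unfolding tridiagonal_pair_def by blast+
  interpret S: q_split_operators scale A As d \<theta> \<theta>s U q a as
  proof (intro q_split_operators.intro split_operators.intro endomorphisms_axioms
      split_operators_axioms.intro q_split_operators_axioms.intro)
    show "bij_betw \<theta> {..d} (eigenvalues scale A)" "bij_betw \<theta>s {..d} (eigenvalues scale As)"
      using \<theta>_standard \<theta>s_standard by (simp_all add: standard_eigenvalues_def)
    show "q ^ n \<noteq> 1" if "0 < n" for n using q_not_root_of_unity that by blast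
  qed (fact TD' split q_nonzero Serre Serre_dual \<theta>_def \<theta>s_def)+
  interpret raising_lowering scale q R L S.G d
    unfolding R_def L_def by (rule S.raising_lowering)

  have generate: "span (words w) = UNIV" if w: "w \<in> U 0" "w \<noteq> 0" for w
  proof (rule irreducible[OF subspace_span])
    show "A ` span (words w) \<subseteq> span (words w)" "As ` span (words w) \<subseteq> span (words w)"
      using S.words_span_invariant_subspace[OF S.raising_lowering w(1)] unfolding R_def L_def by blast+
    have "w \<in> words w" unfolding words_def by (intro CollectI exI[of _ "[]"]) simp
    then show "span (words w) \<noteq> {0}" using w(2) span_base by blast
  qed
  have spanning: "U j = span {alt_word js L R w |js. admissible d j js}"
    if w: "w \<in> U 0" "w \<noteq> 0" "\<And>n. \<exists>e. (L ^^ n) ((R ^^ n) w) = scale e w" and j: "j \<le> d" for w j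
  proof -
    have "w \<in> S.G 0" using w(1) S.G_U[of 0] by simp
    then have "S.G (int j) = span {alt_word js L R w |js. admissible d j js}"
      using w(3) generate[OF w(1,2)] S.F_properties(1)[OF j]
      by (rule G_eq_span_admissible) (simp_all add: S.F_G j)
    then show ?thesis using S.G_U[OF j] by simp
  qed

  (* The argument needs a common eigenvector of all L^n R^n. Its conclusion for i = 0 says that
     U 0 is the line of that vector, which then contains v. *)
  have "\<exists>w\<in>U 0. w \<noteq> 0 \<and> (\<forall>n. \<exists>e. ((L ^^ n) \<circ> (R ^^ n)) w = scale e w)"
  proof (rule common_eigenvector[where T = "\<lambda>n. (L ^^ n) \<circ> (R ^^ n)"])
    show "lin ((L ^^ n) \<circ> (R ^^ n))" for n
      using lin_compose[OF lin_funpow[OF lin_L] lin_funpow[OF lin_R]] by (simp add: o_def)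
    show "subspace (U 0)" "U 0 \<noteq> {0}" using S.subspace_U v_in v_nonzero by auto
    show "((L ^^ n) \<circ> (R ^^ n)) w \<in> U 0" if "w \<in> U 0" for n w
      using L_funpow_G[OF R_funpow_G[of w 0 n], of n] that S.G_U[of 0] by simp
    show "((L ^^ m) \<circ> (R ^^ m)) (((L ^^ n) \<circ> (R ^^ n)) w) = ((L ^^ n) \<circ> (R ^^ n)) (((L ^^ m) \<circ> (R ^^ m)) w)"
      if "w \<in> U 0" for m n w
      using L_R_commute[of w m n] that S.G_U[of 0] by simp
  qed
  then obtain w where w: "w \<in> U 0" "w \<noteq> 0" "\<And>n. \<exists>e. (L ^^ n) ((R ^^ n) w) = scale e w" by auto
  have "U 0 = span {w}" using spanning[OF w, of 0] by (simp add: admissible_zero_iff)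
  then obtain c where c: "v = scale c w" using v_in by (auto simp: span_singleton)
  have "\<exists>e. (L ^^ n) ((R ^^ n) v) = scale e v" for n
  proof -
    obtain e where "(L ^^ n) ((R ^^ n) w) = scale e w" using w(3) by blast
    then have "(L ^^ n) ((R ^^ n) v) = scale e v" by (simp add: c L_simps R_simps mult.commute)
    then show ?thesis by blast
  qed
  then show ?thesis using spanning[OF v_in v_nonzero _ i_le] by blast
qed

end
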